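(* Let $(\mathcal{A},\sigma)$ be a symmetric quiver algebra, $\varepsilon\in\{+1,-1\}$, $(V,\langle-,-\rangle)$ an $\varepsilon$-quadratic space for $(\mathcal{A},\sigma)$, and let $M,N$ be $\varepsilon$-representations of $\mathcal{A}$ with respect to $(V,\langle-,-\rangle)$. If $M\leq_{\mathrm{Ext}}^{\varepsilon}N$ then $M\leq_{\deg}^{\varepsilon}N$.
   Context: The ground field is $\mathbb{C}$; all representations are finite-dimensional. A symmetric quiver $(\mathcal{Q},\sigma)$ is a finite quiver with an involution $\sigma$ of its vertices and of its arrows which reverses arrows: if $\alpha:i\to j$ then $\sigma(\alpha):\sigma(j)\to\sigma(i)$. A symmetric quiver algebra is $\mathcal{A}=\mathbb{C}\mathcal{Q}/I$ with $I$ an admissible ideal such that $\sigma(I)=I$ (with $\sigma$ extended to an anti-automorphism of the path algebra). An $\varepsilon$-quadratic space is a finite-dimensional $\mathcal{Q}_0$-graded vector space $V=\bigoplus_iV_i$ with a non-degenerate bilinear form such that $\langle V_i,V_j\rangle=0$ if $j\neq\sigma(i)$ and $\langle v,w\rangle=\varepsilon\langle w,v\rangle$. $R(\mathcal{A},V)$ is the variety of $\mathcal{A}$-representations on $V$ (tuples of linear maps $M_\alpha:V_i\to V_j$, $\alpha:i\to j$, satisfying the relations in $I$). An $\varepsilon$-representation with respect to $(V,\langle-,-\rangle)$ is $M\in R(\mathcal{A},V)$ with $\langle M_\alpha v,w\rangle+\langle v,M_{\sigma(\alpha)}w\rangle=0$ for all arrows $\alpha:i\to j$, $v\in V_i$,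 $w\in V_{\sigma(j)}$. $G^\bullet$ is the group of graded isometries: $g\in\prod_i\mathrm{GL}(V_i)$ with $\langle gv,gw\rangle=\langle v,w\rangle$, acting by $(g\cdot M)_\alpha=g_jM_\alpha g_i^{-1}$. $M\leq_{\deg}^\varepsilon N$ means $N\in\overline{G^\bullet M}$ (Zariski closure). For a representation $L$ with underlying space $W$, $\nabla L$ has underlying space $(\nabla W)_i=W_{\sigma(i)}^*$ and maps $(\nabla L)_\alpha=-L_{\sigma(\alpha)}^*$. A subrepresentation $L\subseteq M$ of an $\varepsilon$-representation is isotropic if $L\subseteq L^\perp=\{v\in V:\langle v,l\rangle=0\ \forall l\in L\}$; then $L^\perp$ is a subrepresentation and $L^\perp/L$ is an $\varepsilon$-representation for the induced form. $L\oplus\nabla L$ is an $\varepsilon$-representation via the natural pairing between $L$ and $\nabla L$. Isomorphism of $\varepsilon$-representations means an isomorphism of representations preserving the forms. $M\leq_{\mathrm{Ext}}^\varepsilon N$ means that there are $\varepsilon$-representations $M=M_1,\dots,M_k=N$ with respect to $(V,\langle-,-\rangle)$ such that for every $i=2,\dots,k$ there is an isotropic subrepresentation $L_i$ of $M_{i-1}$ with $M_i\simeq L_i\oplus\nabla L_i\oplus L_i^\perp/L_i$. *)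

theory Defs
  imports
    "Jordan_Normal_Form.VS_Connect"
    "Graph_Theory.Arc_Walk"
    "HOL-Algebra.Ideal_Product"
begin

section \<open>Symmetric quiver algebras\<close>

text \<open>
  A path is a pair of its start vertex and the list of its arrows in the order in which they are
  traversed; \<^term>\<open>(u, [])\<close> is the lazy path at \<^term>\<open>u\<close>.
\<close>

definition quiver_paths :: "('v, 'e) pre_digraph \<Rightarrow> ('v \<times> 'e list) set" where
  "quiver_paths Q = {(u, p). \<exists>v. pre_digraph.awalk Q u p v}"

text \<open>
  Elements of the path algebra are finitely supported coefficient functions on paths. The product
  of two paths is ``first the left one, then the right one''; the other convention gives the
  opposite algebra, which has the same two-sided ideals and the same anti-automorphisms.
\<close>

definition path_algebra :: "('v, 'e) pre_digraph \<Rightarrow> ('v \<times> 'e list \<Rightarrow> complex) ring" where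
  "path_algebra Q =
     \<lparr> carrier = {x. finite {q. x q \<noteq> 0} \<and> {q. x q \<noteq> 0} \<subseteq> quiver_paths Q},
       mult = (\<lambda>x y (u, p). \<Sum>k\<le>length p.
                 x (u, take k p) * y (pre_digraph.awlast Q u (take k p), drop k p)),
       one = (\<lambda>(u, p). if u \<in> verts Q \<and> p = [] then 1 else 0),
       zero = (\<lambda>q. 0),
       add = (\<lambda>x y q. x q + y q) \<rparr>"

definition arrow_element :: "('v, 'e) pre_digraph \<Rightarrow> 'e \<Rightarrow> ('v \<times> 'e list \<Rightarrow> complex)" where
  "arrow_element Q \<alpha> = (\<lambda>q. if q = (tail Q \<alpha>, [\<alpha>]) then 1 else 0)"

definition arrow_ideal :: "('v, 'e) pre_digraph \<Rightarrow> ('v \<times> 'e list \<Rightarrow> complex) set" where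
  "arrow_ideal Q = genideal (path_algebra Q) (arrow_element Q ` arcs Q)"

definition admissible_ideal ::
  "('v, 'e) pre_digraph \<Rightarrow> ('v \<times> 'e list \<Rightarrow> complex) set \<Rightarrow> bool" where
  "admissible_ideal Q I \<longleftrightarrow>
     ideal I (path_algebra Q) \<and>
     (\<exists>m\<ge>2. arrow_ideal Q [^]\<^bsub>ideals_set (path_algebra Q)\<^esub> (m::nat) \<subseteq> I) \<and>
     I \<subseteq> arrow_ideal Q [^]\<^bsub>ideals_set (path_algebra Q)\<^esub> (2::nat)"

definition sigma_path ::
  "('v, 'e) pre_digraph \<Rightarrow> ('v \<Rightarrow> 'v) \<Rightarrow> ('e \<Rightarrow> 'e) \<Rightarrow> 'v \<times> 'e list \<Rightarrow> 'v \<times> 'e list" where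
  "sigma_path Q sv sa = (\<lambda>(u, p). (sv (pre_digraph.awlast Q u p), rev (map sa p)))"

text \<open>The linear extension of \<^const>\<open>sigma_path\<close> to the path algebra.\<close>

definition sigma_alg ::
  "('v, 'e) pre_digraph \<Rightarrow> ('v \<Rightarrow> 'v) \<Rightarrow> ('e \<Rightarrow> 'e) \<Rightarrow>
   ('v \<times> 'e list \<Rightarrow> complex) \<Rightarrow> ('v \<times> 'e list \<Rightarrow> complex)" where
  "sigma_alg Q sv sa x = (\<lambda>q. \<Sum>q' \<in> {q'. x q' \<noteq> 0 \<and> sigma_path Q sv sa q' = q}. x q')"

locale symmetric_quiver = fin_digraph Q
  for Q :: "('v, 'e) pre_digraph" +
  fixes sv :: "'v \<Rightarrow> 'v" and sa :: "'e \<Rightarrow> 'e"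
  assumes sv_verts: "i \<in> verts Q \<Longrightarrow> sv i \<in> verts Q"
    and sv_sv: "i \<in> verts Q \<Longrightarrow> sv (sv i) = i"
    and sa_arcs: "\<alpha> \<in> arcs Q \<Longrightarrow> sa \<alpha> \<in> arcs Q"
    and sa_sa: "\<alpha> \<in> arcs Q \<Longrightarrow> sa (sa \<alpha>) = \<alpha>"
    and tail_sa: "\<alpha> \<in> arcs Q \<Longrightarrow> tail Q (sa \<alpha>) = sv (head Q \<alpha>)"
    and head_sa: "\<alpha> \<in> arcs Q \<Longrightarrow> head Q (sa \<alpha>) = sv (tail Q \<alpha>)"

locale symmetric_quiver_algebra = symmetric_quiver Q sv sa
  for Q :: "('v, 'e) pre_digraph" and sv :: "'v \<Rightarrow> 'v" and sa :: "'e \<Rightarrow> 'e" +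
  fixes I :: "('v \<times> 'e list \<Rightarrow> complex) set"
  assumes admissible: "admissible_ideal Q I"
    and sigma_I: "sigma_alg Q sv sa ` I = I"


section \<open>Linear algebra over the complex numbers\<close>

definition scalar_space :: "(complex, complex) module" where
  "scalar_space = \<lparr> carrier = UNIV, mult = (*), one = 1, zero = 0, add = (+), smult = (*) \<rparr>"

text \<open>Linear maps are extensional, so that they are equal iff they agree on the domain.\<close>

definition lin_maps :: "(complex, 'a) module \<Rightarrow> (complex, 'b) module \<Rightarrow> ('a \<Rightarrow> 'b) set" where
  "lin_maps V W = LinearCombinations.module_hom class_ring V W \<inter> extensional (carrier V)"

definition dual_space :: "(complex, 'a) module \<Rightarrow> (complex, 'a \<Rightarrow> complex) module" where
  "dual_space V =
     (ring.func_space class_ring (carrier V)) \<lparr> carrier := lin_maps V scalar_space \<rparr>"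

text \<open>The quotient \<open>V/N\<close>, as the space of cosets.\<close>

definition quot_space :: "(complex, 'a) module \<Rightarrow> 'a set \<Rightarrow> (complex, 'a set) module" where
  "quot_space V N =
     \<lparr> carrier = a_rcosets\<^bsub>V\<^esub> N,
       mult = (\<lambda>X Y. N),
       one = N,
       zero = N,
       add = set_add V,
       smult = (\<lambda>c X. \<Union>x\<in>X. N +>\<^bsub>V\<^esub> (c \<odot>\<^bsub>V\<^esub> x)) \<rparr>"


section \<open>Representations and quadratic spaces\<close>

text \<open>
  A graded space is the family \<^term>\<open>V\<close> of its homogeneous components. A bilinear form on the
  direct sum of the components is given by its blocks \<open>B i j\<close>, the restrictions of the form to
  \<open>V i \<times> V j\<close>.
\<close>

locale quadratic_space =
  fixes Q :: "('v, 'e) pre_digraph" and sv :: "'v \<Rightarrow> 'v" and \<epsilon> :: complex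
    and V :: "'v \<Rightarrow> (complex, 'a) module"
    and B :: "'v \<Rightarrow> 'v \<Rightarrow> 'a \<Rightarrow> 'a \<Rightarrow> complex"
  assumes vectorspace: "i \<in> verts Q \<Longrightarrow> vectorspace class_ring (V i)"
    and fin_dim: "i \<in> verts Q \<Longrightarrow> vectorspace.fin_dim class_ring (V i)"
    and linear_left: "\<lbrakk>i \<in> verts Q; j \<in> verts Q; w \<in> carrier (V j)\<rbrakk>
          \<Longrightarrow> (\<lambda>v. B i j v w) \<in> LinearCombinations.module_hom class_ring (V i) scalar_space"
    and linear_right: "\<lbrakk>i \<in> verts Q; j \<in> verts Q; v \<in> carrier (V i)\<rbrakk>
          \<Longrightarrow> (\<lambda>w. B i j v w) \<in> LinearCombinations.module_hom class_ring (V j) scalar_space"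
    and nondegenerate: "\<lbrakk>i \<in> verts Q; v \<in> carrier (V i);
            \<And>j w. \<lbrakk>j \<in> verts Q; w \<in> carrier (V j)\<rbrakk> \<Longrightarrow> B i j v w = 0\<rbrakk>
          \<Longrightarrow> v = \<zero>\<^bsub>V i\<^esub>"
    and graded: "\<lbrakk>i \<in> verts Q; j \<in> verts Q; j \<noteq> sv i;
            v \<in> carrier (V i); w \<in> carrier (V j)\<rbrakk> \<Longrightarrow> B i j v w = 0"
    and eps_symmetric: "\<lbrakk>i \<in> verts Q; j \<in> verts Q;
            v \<in> carrier (V i); w \<in> carrier (V j)\<rbrakk> \<Longrightarrow> B i j v w = \<epsilon> * B j i w v"

text \<open>
  The path \<^term>\<open>p = [\<alpha>\<^sub>1, \<alpha>\<^sub>2]\<close> acts by \<open>fold M p = M \<alpha>\<^sub>2 \<circ> M \<alpha>\<^sub>1\<close>. An element of the path algebra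
  acts on the direct sum of the components; the relation says that all of its blocks
  \<open>V i \<rightarrow> V j\<close> vanish.
\<close>

definition rep_variety ::
  "('v, 'e) pre_digraph \<Rightarrow> ('v \<times> 'e list \<Rightarrow> complex) set \<Rightarrow> ('v \<Rightarrow> (complex, 'a) module) \<Rightarrow>
   ('e \<Rightarrow> 'a \<Rightarrow> 'a) set" where
  "rep_variety Q I V =
     {M \<in> (\<Pi>\<^sub>E \<alpha>\<in>arcs Q. lin_maps (V (tail Q \<alpha>)) (V (head Q \<alpha>))).
        \<forall>x\<in>I. \<forall>i\<in>verts Q. \<forall>j\<in>verts Q. \<forall>v\<in>carrier (V i).
          (\<Oplus>\<^bsub>V j\<^esub> p \<in> {p. x (i, p) \<noteq> 0 \<and> pre_digraph.awalk Q i p j}.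
             x (i, p) \<odot>\<^bsub>V j\<^esub> fold M p v) = \<zero>\<^bsub>V j\<^esub>}"

definition eps_reps ::
  "('v, 'e) pre_digraph \<Rightarrow> ('v \<Rightarrow> 'v) \<Rightarrow> ('e \<Rightarrow> 'e) \<Rightarrow> ('v \<times> 'e list \<Rightarrow> complex) set \<Rightarrow>
   ('v \<Rightarrow> (complex, 'a) module) \<Rightarrow> ('v \<Rightarrow> 'v \<Rightarrow> 'a \<Rightarrow> 'a \<Rightarrow> complex) \<Rightarrow> ('e \<Rightarrow> 'a \<Rightarrow> 'a) set" where
  "eps_reps Q sv sa I V B =
     {M \<in> rep_variety Q I V.
        \<forall>\<alpha>\<in>arcs Q. \<forall>v\<in>carrier (V (tail Q \<alpha>)). \<forall>w\<in>carrier (V (sv (head Q \<alpha>))).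
          B (head Q \<alpha>) (sv (head Q \<alpha>)) (M \<alpha> v) w +
          B (tail Q \<alpha>) (sv (tail Q \<alpha>)) v (M (sa \<alpha>) w) = 0}"


section \<open>Degeneration\<close>

definition isometries ::
  "('v, 'e) pre_digraph \<Rightarrow> ('v \<Rightarrow> (complex, 'a) module) \<Rightarrow>
   ('v \<Rightarrow> 'v \<Rightarrow> 'a \<Rightarrow> 'a \<Rightarrow> complex) \<Rightarrow> ('v \<Rightarrow> 'a \<Rightarrow> 'a) set" where
  "isometries Q V B =
     {g \<in> (\<Pi>\<^sub>E i\<in>verts Q. lin_maps (V i) (V i)).
        (\<forall>i\<in>verts Q. bij_betw (g i) (carrier (V i)) (carrier (V i))) \<and>
        (\<forall>i\<in>verts Q. \<forall>j\<in>verts Q. \<forall>v\<in>carrier (V i). \<forall>w\<in>carrier (V j).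
           B i j (g i v) (g j w) = B i j v w)}"

definition group_act ::
  "('v, 'e) pre_digraph \<Rightarrow> ('v \<Rightarrow> (complex, 'a) module) \<Rightarrow> ('v \<Rightarrow> 'a \<Rightarrow> 'a) \<Rightarrow>
   ('e \<Rightarrow> 'a \<Rightarrow> 'a) \<Rightarrow> ('e \<Rightarrow> 'a \<Rightarrow> 'a)" where
  "group_act Q V g M =
     (\<lambda>\<alpha>\<in>arcs Q. \<lambda>v\<in>carrier (V (tail Q \<alpha>)).
        g (head Q \<alpha>) (M \<alpha> (inv_into (carrier (V (tail Q \<alpha>))) (g (tail Q \<alpha>)) v)))"

text \<open>
  Polynomial functions on the space of all tuples \<^term>\<open>M\<close> of linear maps: the algebra generated by
  the matrix coefficients \<open>M \<mapsto> f (M \<alpha> v)\<close>, with \<^term>\<open>f\<close> a linear functional.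
\<close>

inductive_set polynomial_functions ::
  "('v, 'e) pre_digraph \<Rightarrow> ('v \<Rightarrow> (complex, 'a) module) \<Rightarrow> (('e \<Rightarrow> 'a \<Rightarrow> 'a) \<Rightarrow> complex) set"
  for Q V where
  const: "(\<lambda>M. c) \<in> polynomial_functions Q V"
| coeff: "\<lbrakk>\<alpha> \<in> arcs Q; v \<in> carrier (V (tail Q \<alpha>)); f \<in> lin_maps (V (head Q \<alpha>)) scalar_space\<rbrakk>
    \<Longrightarrow> (\<lambda>M. f (M \<alpha> v)) \<in> polynomial_functions Q V"
| add: "\<lbrakk>P \<in> polynomial_functions Q V; P' \<in> polynomial_functions Q V\<rbrakk>
    \<Longrightarrow> (\<lambda>M. P M + P' M) \<in> polynomial_functions Q V"
| mult: "\<lbrakk>P \<in> polynomial_functions Q V; P' \<in> polynomial_functions Q V\<rbrakk>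
    \<Longrightarrow> (\<lambda>M. P M * P' M) \<in> polynomial_functions Q V"

definition zariski_closed ::
  "('v, 'e) pre_digraph \<Rightarrow> ('v \<times> 'e list \<Rightarrow> complex) set \<Rightarrow> ('v \<Rightarrow> (complex, 'a) module) \<Rightarrow>
   ('e \<Rightarrow> 'a \<Rightarrow> 'a) set \<Rightarrow> bool" where
  "zariski_closed Q I V C \<longleftrightarrow>
     (\<exists>F \<subseteq> polynomial_functions Q V. C = {M \<in> rep_variety Q I V. \<forall>P\<in>F. P M = 0})"

definition zariski_closure ::
  "('v, 'e) pre_digraph \<Rightarrow> ('v \<times> 'e list \<Rightarrow> complex) set \<Rightarrow> ('v \<Rightarrow> (complex, 'a) module) \<Rightarrow>
   ('e \<Rightarrow> 'a \<Rightarrow> 'a) set \<Rightarrow> ('e \<Rightarrow> 'a \<Rightarrow> 'a) set" where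
  "zariski_closure Q I V S = \<Inter>{C. zariski_closed Q I V C \<and> S \<subseteq> C}"

definition deg_le ::
  "('v, 'e) pre_digraph \<Rightarrow> ('v \<times> 'e list \<Rightarrow> complex) set \<Rightarrow> ('v \<Rightarrow> (complex, 'a) module) \<Rightarrow>
   ('v \<Rightarrow> 'v \<Rightarrow> 'a \<Rightarrow> 'a \<Rightarrow> complex) \<Rightarrow> ('e \<Rightarrow> 'a \<Rightarrow> 'a) \<Rightarrow> ('e \<Rightarrow> 'a \<Rightarrow> 'a) \<Rightarrow> bool" where
  "deg_le Q I V B M N \<longleftrightarrow>
     N \<in> zariski_closure Q I V {group_act Q V g M | g. g \<in> isometries Q V B}"


section \<open>Extensions\<close>

text \<open>A representation together with its underlying graded space and the blocks of a form on it.\<close>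

record ('v, 'e, 'a) form_rep =
  component :: "'v \<Rightarrow> (complex, 'a) module"
  amap :: "'e \<Rightarrow> 'a \<Rightarrow> 'a"
  form :: "'v \<Rightarrow> 'v \<Rightarrow> 'a \<Rightarrow> 'a \<Rightarrow> complex"

definition form_rep_iso ::
  "('v, 'e) pre_digraph \<Rightarrow> ('v, 'e, 'a) form_rep \<Rightarrow> ('v, 'e, 'b) form_rep \<Rightarrow> bool" where
  "form_rep_iso Q X Y \<longleftrightarrow>
     (\<exists>\<phi>. (\<forall>i\<in>verts Q. \<phi> i \<in> LinearCombinations.module_hom class_ring (component X i) (component Y i) \<and>
                        bij_betw (\<phi> i) (carrier (component X i)) (carrier (component Y i))) \<and>
          (\<forall>\<alpha>\<in>arcs Q. \<forall>v\<in>carrier (component X (tail Q \<alpha>)).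
              \<phi> (head Q \<alpha>) (amap X \<alpha> v) = amap Y \<alpha> (\<phi> (tail Q \<alpha>) v)) \<and>
          (\<forall>i\<in>verts Q. \<forall>j\<in>verts Q. \<forall>v\<in>carrier (component X i). \<forall>w\<in>carrier (component X j).
              form Y i j (\<phi> i v) (\<phi> j w) = form X i j v w))"

definition form_rep_sum ::
  "('v, 'e, 'a) form_rep \<Rightarrow> ('v, 'e, 'b) form_rep \<Rightarrow> ('v, 'e, 'a \<times> 'b) form_rep" where
  "form_rep_sum X Y =
     \<lparr> component = (\<lambda>i. direct_sum (component X i) (component Y i)),
       amap = (\<lambda>\<alpha>. map_prod (amap X \<alpha>) (amap Y \<alpha>)),
       form = (\<lambda>i j (x, y) (x', y'). form X i j x x' + form Y i j y y') \<rparr>"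

definition subrep ::
  "('v, 'e) pre_digraph \<Rightarrow> ('v \<Rightarrow> (complex, 'a) module) \<Rightarrow> ('e \<Rightarrow> 'a \<Rightarrow> 'a) \<Rightarrow>
   ('v \<Rightarrow> 'a set) \<Rightarrow> bool" where
  "subrep Q V M L \<longleftrightarrow>
     (\<forall>i\<in>verts Q. VectorSpace.subspace class_ring (L i) (V i)) \<and>
     (\<forall>\<alpha>\<in>arcs Q. M \<alpha> ` L (tail Q \<alpha>) \<subseteq> L (head Q \<alpha>))"

definition perp ::
  "('v, 'e) pre_digraph \<Rightarrow> ('v \<Rightarrow> (complex, 'a) module) \<Rightarrow>
   ('v \<Rightarrow> 'v \<Rightarrow> 'a \<Rightarrow> 'a \<Rightarrow> complex) \<Rightarrow> ('v \<Rightarrow> 'a set) \<Rightarrow> 'v \<Rightarrow> 'a set" where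
  "perp Q V B L i = {v \<in> carrier (V i). \<forall>j\<in>verts Q. \<forall>l\<in>L j. B i j v l = 0}"

definition isotropic_subrep ::
  "('v, 'e) pre_digraph \<Rightarrow> ('v \<Rightarrow> (complex, 'a) module) \<Rightarrow>
   ('v \<Rightarrow> 'v \<Rightarrow> 'a \<Rightarrow> 'a \<Rightarrow> complex) \<Rightarrow> ('e \<Rightarrow> 'a \<Rightarrow> 'a) \<Rightarrow> ('v \<Rightarrow> 'a set) \<Rightarrow> bool" where
  "isotropic_subrep Q V B M L \<longleftrightarrow> subrep Q V M L \<and> (\<forall>i\<in>verts Q. L i \<subseteq> perp Q V B L i)"

text \<open>\<open>\<nabla>L\<close> for a representation \<open>L\<close> with components \<^term>\<open>W\<close> and maps \<^term>\<open>M\<close>.\<close>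

definition nabla_comp ::
  "('v \<Rightarrow> 'v) \<Rightarrow> ('v \<Rightarrow> (complex, 'a) module) \<Rightarrow> 'v \<Rightarrow> (complex, 'a \<Rightarrow> complex) module" where
  "nabla_comp sv W i = dual_space (W (sv i))"

definition nabla_map ::
  "('v, 'e) pre_digraph \<Rightarrow> ('e \<Rightarrow> 'e) \<Rightarrow> ('v \<Rightarrow> (complex, 'a) module) \<Rightarrow> ('e \<Rightarrow> 'a \<Rightarrow> 'a) \<Rightarrow>
   'e \<Rightarrow> ('a \<Rightarrow> complex) \<Rightarrow> ('a \<Rightarrow> complex)" where
  "nabla_map Q sa W M \<alpha> f = (\<lambda>l\<in>carrier (W (tail Q (sa \<alpha>))). - f (M (sa \<alpha>) l))"

text \<open>
  \<open>L \<oplus> \<nabla>L\<close> with the \<open>\<epsilon>\<close>-symmetric form extending the evaluation pairing \<open>\<langle>l, f\<rangle> = f l\<close>, so that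
  \<open>\<langle>f, l\<rangle> = \<epsilon> f l\<close>, and for which both summands are isotropic. Normalising \<open>\<langle>f, l\<rangle> = f l\<close> instead
  gives an isometric \<open>\<epsilon>\<close>-representation, via \<open>(l, f) \<mapsto> (l, \<epsilon> f)\<close>.
\<close>

definition hyperbolic_rep ::
  "('v, 'e) pre_digraph \<Rightarrow> ('v \<Rightarrow> 'v) \<Rightarrow> ('e \<Rightarrow> 'e) \<Rightarrow> complex \<Rightarrow>
   ('v \<Rightarrow> (complex, 'a) module) \<Rightarrow> ('e \<Rightarrow> 'a \<Rightarrow> 'a) \<Rightarrow>
   ('v, 'e, 'a \<times> ('a \<Rightarrow> complex)) form_rep" where
  "hyperbolic_rep Q sv sa \<epsilon> W M =
     \<lparr> component = (\<lambda>i. direct_sum (W i) (nabla_comp sv W i)),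
       amap = (\<lambda>\<alpha>. map_prod (M \<alpha>) (nabla_map Q sa W M \<alpha>)),
       form = (\<lambda>i j (l, f) (l', f'). if j = sv i then f' l + \<epsilon> * f l' else 0) \<rparr>"

text \<open>
  \<open>L\<^sup>\<bottom>/L\<close>. For isotropic \<^term>\<open>L\<close> the form is constant on \<open>X \<times> Y\<close> for cosets \<^term>\<open>X\<close>, \<^term>\<open>Y\<close>,
  and the union in the maps is a single coset.
\<close>

definition perp_quotient_rep ::
  "('v, 'e) pre_digraph \<Rightarrow> ('v \<Rightarrow> (complex, 'a) module) \<Rightarrow>
   ('v \<Rightarrow> 'v \<Rightarrow> 'a \<Rightarrow> 'a \<Rightarrow> complex) \<Rightarrow> ('e \<Rightarrow> 'a \<Rightarrow> 'a) \<Rightarrow> ('v \<Rightarrow> 'a set) \<Rightarrow>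
   ('v, 'e, 'a set) form_rep" where
  "perp_quotient_rep Q V B M L =
     \<lparr> component = (\<lambda>i. quot_space (V i\<lparr>carrier := perp Q V B L i\<rparr>) (L i)),
       amap = (\<lambda>\<alpha> X. \<Union>x\<in>X. L (head Q \<alpha>) +>\<^bsub>V (head Q \<alpha>)\<^esub> M \<alpha> x),
       form = (\<lambda>i j X Y. the_elem ((\<lambda>(x, y). B i j x y) ` (X \<times> Y))) \<rparr>"

definition ext_le ::
  "('v, 'e) pre_digraph \<Rightarrow> ('v \<Rightarrow> 'v) \<Rightarrow> ('e \<Rightarrow> 'e) \<Rightarrow> ('v \<times> 'e list \<Rightarrow> complex) set \<Rightarrow>
   complex \<Rightarrow> ('v \<Rightarrow> (complex, 'a) module) \<Rightarrow> ('v \<Rightarrow> 'v \<Rightarrow> 'a \<Rightarrow> 'a \<Rightarrow> complex) \<Rightarrow>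
   ('e \<Rightarrow> 'a \<Rightarrow> 'a) \<Rightarrow> ('e \<Rightarrow> 'a \<Rightarrow> 'a) \<Rightarrow> bool" where
  "ext_le Q sv sa I \<epsilon> V B M N \<longleftrightarrow>
     (\<exists>(k::nat) Ms. 1 \<le> k \<and> Ms 1 = M \<and> Ms k = N \<and>
        (\<forall>i\<in>{1..k}. Ms i \<in> eps_reps Q sv sa I V B) \<and>
        (\<forall>i\<in>{2..k}. \<exists>L. isotropic_subrep Q V B (Ms (i - 1)) L \<and>
           form_rep_iso Q
             \<lparr> component = V, amap = Ms i, form = B \<rparr>
             (form_rep_sum
                (hyperbolic_rep Q sv sa \<epsilon> (\<lambda>j. V j\<lparr>carrier := L j\<rparr>) (Ms (i - 1)))
                (perp_quotient_rep Q V B (Ms (i - 1)) L))))"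

end

theory Submission
  imports Defs
begin

text \<open>
  The idea is that a single extension step is the limit of a one-parameter group of isometries.
  Let \<open>M\<close> be an \<open>\<epsilon>\<close>-representation with an isotropic subrepresentation \<open>L\<close>, and let
  \<open>N \<simeq> L \<oplus> \<nabla>L \<oplus> L\<^sup>\<bottom>/L\<close>. By Witt's argument there are a graded projection \<open>e\<close> onto \<open>L\<close> and an
  adjoint \<open>e'\<close> of it with \<open>e e' = e' e = 0\<close> (lemma \<open>isotropic_projection\<close>): \<open>e'\<close> projects onto an
  isotropic complement of \<open>L\<^sup>\<bottom>\<close>, with kernel \<open>L\<^sup>\<bottom>\<close>, and \<open>1 - e - e'\<close> projects onto a complement of \<open>L\<close>
  in \<open>L\<^sup>\<bottom>\<close>. Therefore \<open>\<lambda>(t) = t e + (1 - e - e') + t\<^sup>-\<^sup>1 e'\<close> is an isometry. Because \<open>M\<close> is block triangular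
  for the filtration \<open>L \<subseteq> L\<^sup>\<bottom> \<subseteq> V\<close>, conjugating it with \<open>\<lambda>(t)\<close> multiplies its blocks by \<open>1\<close>, \<open>t\<close>
  or \<open>t\<^sup>2\<close>, so the conjugate is polynomial in \<open>t\<close>, and its value at \<open>t = 0\<close> is the associated
  graded representation \<open>gr M\<close> (lemma \<open>torus_conjugate_polynomial\<close>).

  The map \<open>v \<mapsto> ((e v, \<langle>-, v\<rangle>), [v - e' v])\<close> is an isometric morphism from \<open>gr M\<close> to
  \<open>(L \<oplus> \<nabla>L) \<oplus> L\<^sup>\<bottom>/L\<close> (lemmas \<open>to_degeneration_hom\<close>, \<open>to_degeneration_form\<close>, \<open>to_degeneration_gr\<close>),
  hence \<open>N = g \<cdot> gr M\<close> for some isometry \<open>g\<close>. A polynomial function that vanishes on the orbit of \<open>M\<close>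
  becomes, along \<open>t \<mapsto> g \<lambda>(t) \<cdot> M\<close>, a polynomial in \<open>t\<close> with infinitely many zeros, so it
  vanishes at \<open>t = 0\<close>, that is at \<open>N\<close> (lemma \<open>extension_specializes\<close>). The relation ``every
  polynomial function vanishing on the orbit of \<open>M\<close> vanishes at \<open>N\<close>'' is transitive, since the group acts
  by polynomial maps (lemma \<open>orbit_specializes_trans\<close>); so the steps of a chain compose.

  Identities between vectors are proved by pairing both sides with all vectors. Non-degeneracy thus
  reduces them to identities between complex numbers.
\<close>

section \<open>Linear algebra\<close>

lemma (in vectorspace) subspace_finite_spanning_set:
  assumes fd: "fin_dim" and W: "VectorSpace.subspace K W V"
  obtains A where "finite A" "A \<subseteq> W" "lin_indpt A" "span A = W"
    "vectorspace.basis K (vs W) A"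
proof -
  interpret W: vectorspace K "vs W" by (rule subspace_is_vs[OF W])
  have sub: "submodule K W V" using W by simp
  have WV: "W \<subseteq> carrier V" using sub by (simp add: submodule.subset)
  have "\<exists>A. finite A \<and> maximal A (\<lambda>A. A \<subseteq> W \<and> lin_indpt A)"
  proof (rule maximal_exists)
    show "finite A \<and> card A \<le> dim" if "A \<subseteq> W \<and> lin_indpt A" for A
      using li_le_dim[OF fd, of A] that WV by blast
    show "{} \<subseteq> W \<and> lin_indpt {}" by (simp add: lin_dep_def)
  qed
  then obtain A where A: "finite A" "maximal A (\<lambda>A. A \<subseteq> W \<and> lin_indpt A)" by blast
  have li: "W.lin_indpt S \<longleftrightarrow> lin_indpt S" if "S \<subseteq> W" for S
    using span_li_not_depend(2)[OF that sub] by simp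
  have "maximal A (\<lambda>S. S \<subseteq> carrier (vs W) \<and> W.lin_indpt S)"
    using A(2) li unfolding maximal_def by auto
  then have basis: "W.basis A" by (rule W.max_li_is_basis)
  have AW: "A \<subseteq> W" "lin_indpt A" using A(2) unfolding maximal_def by blast+
  have "span A = W"
    using basis span_li_not_depend(1)[OF AW(1) sub] unfolding W.basis_def by simp
  then show thesis using that A(1) AW basis by blast
qed

lemma injective_endomorphism_surj:
  assumes T: "linear_map K V V T" and fd: "vectorspace.fin_dim K V"
    and inj: "inj_on T (carrier V)"
  shows "T ` carrier V = carrier V"
proof -
  interpret linear_map K V V T by (rule T)
  obtain A where A: "finite A" "A \<subseteq> imT" "V.module.lin_indpt A" "V.module.span A = imT"
    "vectorspace.basis K (V.vs imT) A"
    using V.subspace_finite_spanning_set[OF fd imT_is_subspace] .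
  interpret im: vectorspace K "V.vs imT" by (rule V.subspace_is_vs[OF imT_is_subspace])
  have imV: "imT \<subseteq> carrier V" by (auto simp: im_def)
  have "im.dim = card A" by (rule im.dim_basis[OF A(1,5)])
  moreover have "im.dim = V.dim" using rank_nullity[OF fd] inj_imp_dim_ker0[OF inj] by simp
  ultimately have "V.basis A" using A imV by (intro V.dim_li_is_basis fd) auto
  then have "imT = carrier V" using A(4) unfolding V.basis_def by simp
  then show ?thesis unfolding im_def .
qed

text \<open>
  Linear maps that need not be extensional, so that they can be built by ordinary
  \<open>\<lambda>\<close>-abstraction and composition; they are restricted to the carrier only where membership in
  \<open>lin_maps\<close> matters.
\<close>

abbreviation lhom ::
  "(complex, 'a) module \<Rightarrow> (complex, 'b) module \<Rightarrow> ('a \<Rightarrow> 'b) set" where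
  "lhom \<equiv> LinearCombinations.module_hom class_ring"

lemma lhomI:
  assumes "\<And>x. x \<in> carrier X \<Longrightarrow> f x \<in> carrier Y"
    and "\<And>x y. x \<in> carrier X \<Longrightarrow> y \<in> carrier X \<Longrightarrow> f (x \<oplus>\<^bsub>X\<^esub> y) = f x \<oplus>\<^bsub>Y\<^esub> f y"
    and "\<And>c x. x \<in> carrier X \<Longrightarrow> f (c \<odot>\<^bsub>X\<^esub> x) = c \<odot>\<^bsub>Y\<^esub> f x"
  shows "f \<in> lhom X Y"
  using assms by (auto simp: LinearCombinations.module_hom_def)

lemma lhomD:
  assumes "f \<in> lhom X Y" "x \<in> carrier X"
  shows lhom_closed: "f x \<in> carrier Y"
    and lhom_add: "y \<in> carrier X \<Longrightarrow> f (x \<oplus>\<^bsub>X\<^esub> y) = f x \<oplus>\<^bsub>Y\<^esub> f y"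
    and lhom_smult: "f (c \<odot>\<^bsub>X\<^esub> x) = c \<odot>\<^bsub>Y\<^esub> f x"
  using assms by (auto simp: LinearCombinations.module_hom_def)

lemma functional_add:
  "\<lbrakk>f \<in> lhom X scalar_space; x \<in> carrier X; y \<in> carrier X\<rbrakk> \<Longrightarrow> f (x \<oplus>\<^bsub>X\<^esub> y) = f x + f y"
  by (simp add: lhom_add scalar_space_def)

lemma functional_smult:
  "\<lbrakk>f \<in> lhom X scalar_space; x \<in> carrier X\<rbrakk> \<Longrightarrow> f (c \<odot>\<^bsub>X\<^esub> x) = c * f x"
  by (simp add: lhom_smult scalar_space_def)

lemma functionalI:
  assumes "\<And>x y. x \<in> carrier X \<Longrightarrow> y \<in> carrier X \<Longrightarrow> f (x \<oplus>\<^bsub>X\<^esub> y) = f x + f y"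
    and "\<And>c x. x \<in> carrier X \<Longrightarrow> f (c \<odot>\<^bsub>X\<^esub> x) = c * f x"
  shows "f \<in> lhom X scalar_space"
  using assms by (auto intro!: lhomI simp: scalar_space_def)

lemma lin_maps_imp_lhom: "f \<in> lin_maps X Y \<Longrightarrow> f \<in> lhom X Y"
  by (simp add: lin_maps_def)

lemma restrict_in_lin_maps:
  assumes "f \<in> lhom X Y" "Module.module class_ring X"
  shows "restrict f (carrier X) \<in> lin_maps X Y"
proof -
  interpret Module.module class_ring X by (rule assms(2))
  show ?thesis using assms(1) by (auto simp: lin_maps_def lhomD intro!: lhomI)
qed

section \<open>Forms, adjoints and isotropic projections\<close>

locale symmetric_quadratic_space =
  symmetric_quiver Q sv sa + quadratic_space Q sv \<epsilon> V B
  for Q :: "('v, 'e) pre_digraph" and sv :: "'v \<Rightarrow> 'v" and sa :: "'e \<Rightarrow> 'e"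
    and \<epsilon> :: complex and V :: "'v \<Rightarrow> (complex, 'a) module"
    and B :: "'v \<Rightarrow> 'v \<Rightarrow> 'a \<Rightarrow> 'a \<Rightarrow> complex" +
  assumes eps: "\<epsilon> \<in> {1, -1}"
begin

declare sv_verts [simp] sv_sv [simp] sa_arcs [simp]

lemma eps_eps [simp]: "\<epsilon> * (\<epsilon> * c) = c" using eps by auto

lemma V_module: "i \<in> verts Q \<Longrightarrow> Module.module class_ring (V i)"
  using vectorspace by (simp add: vectorspace_def)

lemma V_add [simp, intro]:
  "\<lbrakk>i \<in> verts Q; x \<in> carrier (V i); y \<in> carrier (V i)\<rbrakk> \<Longrightarrow> x \<oplus>\<^bsub>V i\<^esub> y \<in> carrier (V i)"
proof -
  assume "i \<in> verts Q"
  then interpret Module.module class_ring "V i" by (rule V_module)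
  show "x \<in> carrier (V i) \<Longrightarrow> y \<in> carrier (V i) \<Longrightarrow> ?thesis" by simp
qed

lemma V_smult [simp, intro]:
  "\<lbrakk>i \<in> verts Q; x \<in> carrier (V i)\<rbrakk> \<Longrightarrow> c \<odot>\<^bsub>V i\<^esub> x \<in> carrier (V i)"
  using Module.module.smult_closed[OF V_module, of i c x] by simp

lemma V_zero [simp, intro]: "i \<in> verts Q \<Longrightarrow> \<zero>\<^bsub>V i\<^esub> \<in> carrier (V i)"
proof -
  assume "i \<in> verts Q"
  then interpret Module.module class_ring "V i" by (rule V_module)
  show ?thesis by simp
qed

lemma B_left:
  assumes "i \<in> verts Q" "j \<in> verts Q" "w \<in> carrier (V j)" "x \<in> carrier (V i)"
  shows B_add_left: "y \<in> carrier (V i) \<Longrightarrow> B i j (x \<oplus>\<^bsub>V i\<^esub> y) w = B i j x w + B i j y w"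
    and B_smult_left: "B i j (c \<odot>\<^bsub>V i\<^esub> x) w = c * B i j x w"
  using functional_add[OF linear_left[OF assms(1-3)]] functional_smult[OF linear_left[OF assms(1-3)]]
    assms(4) by auto

lemma B_right:
  assumes "i \<in> verts Q" "j \<in> verts Q" "w \<in> carrier (V i)" "x \<in> carrier (V j)"
  shows B_add_right: "y \<in> carrier (V j) \<Longrightarrow> B i j w (x \<oplus>\<^bsub>V j\<^esub> y) = B i j w x + B i j w y"
    and B_smult_right: "B i j w (c \<odot>\<^bsub>V j\<^esub> x) = c * B i j w x"
  using functional_add[OF linear_right[OF assms(1-3)]] functional_smult[OF linear_right[OF assms(1-3)]]
    assms(4) by auto

lemma B_zero_left:
  assumes "i \<in> verts Q" "j \<in> verts Q" "w \<in> carrier (V j)"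
  shows "B i j \<zero>\<^bsub>V i\<^esub> w = 0"
proof -
  interpret Module.module class_ring "V i" by (rule V_module[OF assms(1)])
  have "0 \<odot>\<^bsub>V i\<^esub> \<zero>\<^bsub>V i\<^esub> = \<zero>\<^bsub>V i\<^esub>" using smult_r_null[of 0] by simp
  then show ?thesis using B_smult_left[OF assms V_zero[OF assms(1)], of 0] by simp
qed

lemma B_zero_right:
  assumes "i \<in> verts Q" "j \<in> verts Q" "w \<in> carrier (V i)"
  shows "B i j w \<zero>\<^bsub>V j\<^esub> = 0"
  using assms by (simp add: eps_symmetric[of i j] B_zero_left)

lemmas B_simps = B_add_left B_smult_left B_add_right B_smult_right B_zero_left B_zero_right

lemma V_eqI:
  assumes i: "i \<in> verts Q" and x: "x \<in> carrier (V i)" and y: "y \<in> carrier (V i)"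
    and eq: "\<And>j w. \<lbrakk>j \<in> verts Q; w \<in> carrier (V j)\<rbrakk> \<Longrightarrow> B i j x w = B i j y w"
  shows "x = y"
proof -
  interpret Module.module class_ring "V i" by (rule V_module[OF i])
  define z where "z = (-1) \<odot>\<^bsub>V i\<^esub> y"
  have z: "z \<in> carrier (V i)" using i y by (simp add: z_def)
  have "u \<oplus>\<^bsub>V i\<^esub> z = \<zero>\<^bsub>V i\<^esub>" if "u \<in> {x, y}" for u
    by (rule nondegenerate) (use that i x y z eq in \<open>auto simp: B_simps z_def\<close>)
  then have "x \<oplus>\<^bsub>V i\<^esub> z = y \<oplus>\<^bsub>V i\<^esub> z" by simp
  then show ?thesis using x y z by (simp add: M.add.right_cancel)
qed

lemma V_eqI_right:
  assumes "i \<in> verts Q" "x \<in> carrier (V i)" "y \<in> carrier (V i)"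
    and "\<And>j w. \<lbrakk>j \<in> verts Q; w \<in> carrier (V j)\<rbrakk> \<Longrightarrow> B j i w x = B j i w y"
  shows "x = y"
proof (rule V_eqI[OF assms(1-3)])
  fix j w assume "j \<in> verts Q" "w \<in> carrier (V j)"
  then show "B i j x w = B i j y w"
    using assms eps_symmetric[of i j x w] eps_symmetric[of i j y w] by simp
qed

lemma smult_0: "\<lbrakk>i \<in> verts Q; x \<in> carrier (V i)\<rbrakk> \<Longrightarrow> 0 \<odot>\<^bsub>V i\<^esub> x = \<zero>\<^bsub>V i\<^esub>"
  by (rule V_eqI) (auto simp: B_simps)

lemma lhom_zero:
  assumes "i \<in> verts Q" "j \<in> verts Q" "f \<in> lhom (V i) (V j)"
  shows "f \<zero>\<^bsub>V i\<^esub> = \<zero>\<^bsub>V j\<^esub>"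
  using lhom_smult[OF assms(3) V_zero, of 0] assms by (simp add: smult_0 lhom_closed[OF assms(3)])

lemma functional_zero:
  assumes "i \<in> verts Q" "f \<in> lhom (V i) scalar_space"
  shows "f \<zero>\<^bsub>V i\<^esub> = 0"
proof -
  show ?thesis using functional_smult[OF assms(2) V_zero, of 0] assms(1) by (simp add: smult_0)
qed

text \<open>
  Induction on \<open>S\<close>: if some \<open>v0\<close> is orthogonal to \<open>S\<close> but not to the new element \<open>s\<close>, then
  subtracting the multiple of \<open>\<langle>-, s\<rangle>\<close> that agrees with \<open>f\<close> at \<open>v0\<close> leaves a functional that vanishes on
  \<open>S\<^sup>\<bottom>\<close>; otherwise \<open>S\<close> and \<open>insert s S\<close> have the same orthogonal. This avoids any comparison
  of the dimensions of \<open>V i\<close> and \<open>V (sv i)\<close>.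
\<close>

lemma functional_vanishing_on_perp_represented:
  assumes i: "i \<in> verts Q" and S: "finite S" "S \<subseteq> carrier (V (sv i))"
    and f: "f \<in> lhom (V i) scalar_space"
    and vanish: "\<And>v. \<lbrakk>v \<in> carrier (V i); \<forall>s\<in>S. B i (sv i) v s = 0\<rbrakk> \<Longrightarrow> f v = 0"
  shows "\<exists>u\<in>carrier (V (sv i)). \<forall>v\<in>carrier (V i). f v = B i (sv i) v u"
  using S f vanish
proof (induction S arbitrary: f rule: finite_induct)
  case empty
  then show ?case using i by (intro bexI[of _ "\<zero>\<^bsub>V (sv i)\<^esub>"]) (auto simp: B_simps)
next
  case (insert s S)
  have s: "s \<in> carrier (V (sv i))" and S: "S \<subseteq> carrier (V (sv i))" using insert.prems by auto
  show ?case
  proof (cases "\<exists>v\<in>carrier (V i). (\<forall>s\<in>S. B i (sv i) v s = 0) \<and> B i (sv i) v s \<noteq> 0")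
    case True
    then obtain v0 where v0: "v0 \<in> carrier (V i)" "\<forall>s\<in>S. B i (sv i) v0 s = 0"
      "B i (sv i) v0 s \<noteq> 0" by blast
    define c where "c = f v0 / B i (sv i) v0 s"
    define f' where "f' = (\<lambda>v. f v - c * B i (sv i) v s)"
    have "f' \<in> lhom (V i) scalar_space"
      by (rule functionalI)
        (use i s insert.prems(2) in \<open>auto simp: f'_def functional_add functional_smult B_simps algebra_simps\<close>)
    moreover have "f' v = 0" if v: "v \<in> carrier (V i)" "\<forall>s\<in>S. B i (sv i) v s = 0" for v
    proof -
      \<comment> \<open>\<open>v + d v0\<close> is orthogonal to \<open>s\<close> as well, so \<open>f\<close> kills it\<close>
      define d where "d = - (B i (sv i) v s / B i (sv i) v0 s)"
      have "f (v \<oplus>\<^bsub>V i\<^esub> d \<odot>\<^bsub>V i\<^esub> v0) = 0"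
        using i s S v v0 by (intro insert.prems(3)) (auto simp: B_simps d_def subset_iff)
      then have "f v + d * f v0 = 0"
        using i v v0 insert.prems(2) by (simp add: functional_add functional_smult)
      then show ?thesis using v0(3) by (simp add: f'_def c_def d_def field_simps)
    qed
    ultimately obtain u where u: "u \<in> carrier (V (sv i))"
      "\<forall>v\<in>carrier (V i). f' v = B i (sv i) v u" using insert.IH[OF S] by blast
    show ?thesis
    proof (intro bexI ballI)
      show "u \<oplus>\<^bsub>V (sv i)\<^esub> c \<odot>\<^bsub>V (sv i)\<^esub> s \<in> carrier (V (sv i))" using i u s by simp
      show "f v = B i (sv i) v (u \<oplus>\<^bsub>V (sv i)\<^esub> c \<odot>\<^bsub>V (sv i)\<^esub> s)"
        if "v \<in> carrier (V i)" for v
        using i u s that by (simp add: B_simps flip: u(2)[rule_format]) (simp add: f'_def)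
    qed
  next
    case False
    then have "f v = 0" if "v \<in> carrier (V i)" "\<forall>s\<in>S. B i (sv i) v s = 0" for v
      using that insert.prems(3) by blast
    then show ?thesis by (rule insert.IH[OF S insert.prems(2)])
  qed
qed

lemma submoduleI:
  assumes "i \<in> verts Q" "N \<subseteq> carrier (V i)" "\<zero>\<^bsub>V i\<^esub> \<in> N"
    and "\<And>x y. x \<in> N \<Longrightarrow> y \<in> N \<Longrightarrow> x \<oplus>\<^bsub>V i\<^esub> y \<in> N"
    and "\<And>c x. x \<in> N \<Longrightarrow> c \<odot>\<^bsub>V i\<^esub> x \<in> N"
  shows "submodule class_ring N (V i)"
  using assms V_module[OF assms(1)] by (auto simp: submodule_def)

text \<open>
  Spanning is phrased through submodules, the form in which a property passes from generators to the
  whole subspace: the vectors with the property form a submodule.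
\<close>

lemma finite_generating_set:
  assumes i: "i \<in> verts Q" and L: "VectorSpace.subspace class_ring L (V i)"
  obtains S where "finite S" "S \<subseteq> L"
    "\<forall>N. submodule class_ring N (V i) \<longrightarrow> S \<subseteq> N \<longrightarrow> L \<subseteq> N"
proof -
  interpret vectorspace class_ring "V i" by (rule vectorspace[OF i])
  obtain A where A: "finite A" "A \<subseteq> L" "span A = L"
    using subspace_finite_spanning_set[OF fin_dim[OF i] L] .
  have "L \<subseteq> N" if "submodule class_ring N (V i)" "A \<subseteq> N" for N
    using span_is_subset[OF that(2,1)] A(3) by simp
  then show thesis using that[OF A(1,2)] by simp
qed

text \<open>
  For a finite generating set \<open>S\<close> of \<open>V (sv i)\<close> the orthogonal \<open>S\<^sup>\<bottom>\<close> is zero by non-degeneracy, so every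
  functional vanishes on it.
\<close>

lemma functional_represented:
  assumes i: "i \<in> verts Q" and f: "f \<in> lhom (V i) scalar_space"
  obtains u where "u \<in> carrier (V (sv i))" "\<And>v. v \<in> carrier (V i) \<Longrightarrow> f v = B i (sv i) v u"
proof -
  have svi: "sv i \<in> verts Q" using i by simp
  have "VectorSpace.subspace class_ring (carrier (V (sv i))) (V (sv i))"
    using svi by (auto intro!: VectorSpace.subspace.intro vectorspace submoduleI)
  then obtain S where S: "finite S" "S \<subseteq> carrier (V (sv i))"
    "\<forall>N. submodule class_ring N (V (sv i)) \<longrightarrow> S \<subseteq> N \<longrightarrow> carrier (V (sv i)) \<subseteq> N"
    by (rule finite_generating_set[OF svi])
  have "f v = 0" if v: "v \<in> carrier (V i)" "\<forall>s\<in>S. B i (sv i) v s = 0" for v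
  proof -
    have "submodule class_ring {w \<in> carrier (V (sv i)). B i (sv i) v w = 0} (V (sv i))"
      by (rule submoduleI) (use i v in \<open>auto simp: B_simps\<close>)
    from S(3)[rule_format, OF this] have *: "B i (sv i) v w = 0" if "w \<in> carrier (V (sv i))" for w
      using that v S(2) by blast
    have "v = \<zero>\<^bsub>V i\<^esub>"
    proof (rule nondegenerate[OF i v(1)])
      fix j w assume "j \<in> verts Q" "w \<in> carrier (V j)"
      then show "B i j v w = 0" using * graded[OF i _ _ v(1)] by (cases "j = sv i") auto
    qed
    then show ?thesis using functional_zero[OF i f] by simp
  qed
  then show thesis using functional_vanishing_on_perp_represented[OF i S(1,2) f] that by blast
qed

definition graded_endo :: "('v \<Rightarrow> 'a \<Rightarrow> 'a) \<Rightarrow> bool" where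
  "graded_endo T \<longleftrightarrow> (\<forall>i\<in>verts Q. T i \<in> lhom (V i) (V i))"

definition adjoint :: "('v \<Rightarrow> 'a \<Rightarrow> 'a) \<Rightarrow> ('v \<Rightarrow> 'a \<Rightarrow> 'a) \<Rightarrow> bool" where
  "adjoint S T \<longleftrightarrow> (\<forall>i\<in>verts Q. \<forall>j\<in>verts Q. \<forall>v\<in>carrier (V i). \<forall>w\<in>carrier (V j).
     B i j (S i v) w = B i j v (T j w))"

definition isometric :: "('v \<Rightarrow> 'a \<Rightarrow> 'a) \<Rightarrow> bool" where
  "isometric T \<longleftrightarrow> (\<forall>i\<in>verts Q. \<forall>j\<in>verts Q. \<forall>v\<in>carrier (V i). \<forall>w\<in>carrier (V j).
     B i j (T i v) (T j w) = B i j v w)"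

lemma graded_endoD:
  assumes "graded_endo T" "i \<in> verts Q" "x \<in> carrier (V i)"
  shows graded_endo_closed: "T i x \<in> carrier (V i)"
    and graded_endo_add: "y \<in> carrier (V i) \<Longrightarrow> T i (x \<oplus>\<^bsub>V i\<^esub> y) = T i x \<oplus>\<^bsub>V i\<^esub> T i y"
    and graded_endo_smult: "T i (c \<odot>\<^bsub>V i\<^esub> x) = c \<odot>\<^bsub>V i\<^esub> T i x"
  using assms by (auto simp: graded_endo_def lhomD)

lemma adjointD:
  "\<lbrakk>adjoint S T; i \<in> verts Q; j \<in> verts Q; v \<in> carrier (V i); w \<in> carrier (V j)\<rbrakk>
    \<Longrightarrow> B i j (S i v) w = B i j v (T j w)"
  by (simp add: adjoint_def)

lemma adjoint_sym:
  assumes "graded_endo S" "graded_endo T" "adjoint S T"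
  shows "adjoint T S"
  unfolding adjoint_def
proof (intro ballI)
  fix i j v w
  assume *: "i \<in> verts Q" "j \<in> verts Q" "v \<in> carrier (V i)" "w \<in> carrier (V j)"
  have "B i j (T i v) w = \<epsilon> * B j i (S j w) v"
    using * assms by (simp add: eps_symmetric[of i j "T i v"] graded_endoD adjointD)
  also have "\<dots> = B i j v (S j w)"
    using * assms by (simp add: eps_symmetric[of j i "S j w"] graded_endoD)
  finally show "B i j (T i v) w = B i j v (S j w)" .
qed

text \<open>
  \<open>T w\<close> represents the functional \<open>v \<mapsto> \<langle>S v, w\<rangle>\<close>; by non-degeneracy it is unique, which makes \<open>T\<close> linear.
\<close>

lemma adjoint_exists:
  assumes S: "graded_endo S"
  obtains T where "graded_endo T" "adjoint S T"
proof -
  have ex: "\<exists>u\<in>carrier (V j). \<forall>i\<in>verts Q. \<forall>v\<in>carrier (V i). B i j (S i v) w = B i j v u"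
    if j: "j \<in> verts Q" and w: "w \<in> carrier (V j)" for j w
  proof -
    have "(\<lambda>v. B (sv j) j (S (sv j) v) w) \<in> lhom (V (sv j)) scalar_space"
      by (rule functionalI) (use j w S in \<open>auto simp: graded_endoD B_simps\<close>)
    then obtain u where u: "u \<in> carrier (V j)"
      "\<And>v. v \<in> carrier (V (sv j)) \<Longrightarrow> B (sv j) j (S (sv j) v) w = B (sv j) j v u"
      using functional_represented[of "sv j"] j by (metis sv_sv sv_verts)
    have "B i j (S i v) w = B i j v u" if "i \<in> verts Q" "v \<in> carrier (V i)" for i v
    proof (cases "i = sv j")
      case False
      then have "j \<noteq> sv i" using that j by auto
      then show ?thesis using graded that j w u S by (simp add: graded_endoD)
    qed (use u that in simp)
    then show ?thesis using u by blast
  qed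
  define T where "T j w = (SOME u. u \<in> carrier (V j) \<and>
     (\<forall>i\<in>verts Q. \<forall>v\<in>carrier (V i). B i j (S i v) w = B i j v u))" for j w
  have T: "T j w \<in> carrier (V j) \<and>
     (\<forall>i\<in>verts Q. \<forall>v\<in>carrier (V i). B i j (S i v) w = B i j v (T j w))"
    if "j \<in> verts Q" "w \<in> carrier (V j)" for j w
    unfolding T_def by (rule someI_ex) (use ex[OF that] in blast)
  then have adj: "adjoint S T" by (auto simp: adjoint_def)
  have "graded_endo T"
    unfolding graded_endo_def
  proof (intro ballI lhomI)
    fix i x y c assume i: "i \<in> verts Q" "x \<in> carrier (V i)"
    show "T i x \<in> carrier (V i)" using T i by blast
    show "T i (c \<odot>\<^bsub>V i\<^esub> x) = c \<odot>\<^bsub>V i\<^esub> T i x"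
      by (rule V_eqI_right) (use i S T in \<open>auto simp: B_simps graded_endoD simp flip: adjointD[OF adj]\<close>)
    assume y: "y \<in> carrier (V i)"
    show "T i (x \<oplus>\<^bsub>V i\<^esub> y) = T i x \<oplus>\<^bsub>V i\<^esub> T i y"
      by (rule V_eqI_right) (use i y S T in \<open>auto simp: B_simps graded_endoD simp flip: adjointD[OF adj]\<close>)
  qed
  then show thesis using that adj by blast
qed

text \<open>
  A new vector \<open>x\<close> that \<open>p\<close> does not fix is separated from \<open>p x\<close> by pairing with some \<open>w\<close>. Hence
  \<open>\<langle>v - p v, w\<rangle>\<close>, normalised to take the value \<open>1\<close> at \<open>x\<close>, is a functional that vanishes
  on \<open>S\<close>, and adding that multiple of \<open>x - p x\<close> repairs \<open>p\<close>.
\<close>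

lemma projection_onto_span:
  assumes i: "i \<in> verts Q" and S: "finite S" "S \<subseteq> carrier (V i)"
  shows "\<exists>p \<in> lhom (V i) (V i). (\<forall>s\<in>S. p s = s) \<and>
    (\<forall>N. submodule class_ring N (V i) \<longrightarrow> S \<subseteq> N \<longrightarrow> p ` carrier (V i) \<subseteq> N)"
  using S
proof (induction S rule: finite_induct)
  case empty
  have "(\<lambda>v. \<zero>\<^bsub>V i\<^esub>) \<in> lhom (V i) (V i)"
    by (rule lhomI; (rule V_eqI)?) (use i in \<open>auto simp: B_simps\<close>)
  then show ?case by (rule bexI[rotated]) (auto dest: submodule.zero_closed)
next
  case (insert x S)
  then obtain p where p: "p \<in> lhom (V i) (V i)" "\<forall>s\<in>S. p s = s"
    "\<And>N. submodule class_ring N (V i) \<Longrightarrow> S \<subseteq> N \<Longrightarrow> p ` carrier (V i) \<subseteq> N" by auto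
  have x: "x \<in> carrier (V i)" using insert.prems by simp
  show ?case
  proof (cases "p x = x")
    case True
    then show ?thesis using p by (intro bexI[of _ p]) auto
  next
    case False
    then obtain j w where jw: "j \<in> verts Q" "w \<in> carrier (V j)" "B i j x w \<noteq> B i j (p x) w"
      using V_eqI[OF i x, of "p x"] lhom_closed[OF p(1) x] by metis
    define f where "f v = (B i j v w - B i j (p v) w) / (B i j x w - B i j (p x) w)" for v
    define q where "q v = p v \<oplus>\<^bsub>V i\<^esub> f v \<odot>\<^bsub>V i\<^esub> (x \<oplus>\<^bsub>V i\<^esub> (-1) \<odot>\<^bsub>V i\<^esub> p x)" for v
    have f: "f \<in> lhom (V i) scalar_space"
      by (rule functionalI)
        (use i jw x p(1) in \<open>auto simp: f_def lhomD B_simps diff_divide_distrib add_divide_distrib right_diff_distrib\<close>)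
    have "q \<in> lhom (V i) (V i)"
      by (rule lhomI; (rule V_eqI)?)
        (use i x p(1) f in \<open>auto simp: q_def lhomD[OF p(1)] functional_add functional_smult B_simps algebra_simps\<close>)
    moreover have "q s = s" if "s \<in> insert x S" for s
    proof (rule V_eqI)
      have "f s = (if s = x then 1 else 0)"
        using that jw(3) p(2) insert.hyps by (auto simp: f_def)
      then show "B i k (q s) u = B i k s u" if "k \<in> verts Q" "u \<in> carrier (V k)" for k u
        using that i x p insert.prems \<open>s \<in> insert x S\<close> by (auto simp: q_def B_simps lhomD subset_iff)
    qed (use that i x p(1) insert.prems in \<open>auto simp: q_def lhomD subset_iff\<close>)
    moreover have "q ` carrier (V i) \<subseteq> N"
      if N: "submodule class_ring N (V i)" "insert x S \<subseteq> N" for N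
      using p(3)[OF N(1)] N(2) x
      by (auto simp: q_def intro!: submodule.m_closed[OF N(1)] submodule.smult_closed[OF N(1)])
    ultimately show ?thesis by blast
  qed
qed

lemma graded_projection:
  assumes L: "\<And>i. i \<in> verts Q \<Longrightarrow> VectorSpace.subspace class_ring (L i) (V i)"
  obtains p where "graded_endo p"
    "\<And>i v. i \<in> verts Q \<Longrightarrow> v \<in> carrier (V i) \<Longrightarrow> p i v \<in> L i"
    "\<And>i l. i \<in> verts Q \<Longrightarrow> l \<in> L i \<Longrightarrow> p i l = l"
proof -
  have "\<exists>p \<in> lhom (V i) (V i). p ` carrier (V i) \<subseteq> L i \<and> (\<forall>l\<in>L i. p l = l)"
    if i: "i \<in> verts Q" for i
  proof -
    have sub: "submodule class_ring (L i) (V i)" using L[OF i] by (simp add: VectorSpace.subspace_def)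
    then have LV: "L i \<subseteq> carrier (V i)" by (rule submodule.subset)
    obtain S where S: "finite S" "S \<subseteq> L i"
      "\<forall>N. submodule class_ring N (V i) \<longrightarrow> S \<subseteq> N \<longrightarrow> L i \<subseteq> N"
      using finite_generating_set[OF i L[OF i]] .
    obtain p where p: "p \<in> lhom (V i) (V i)" "\<forall>s\<in>S. p s = s" "p ` carrier (V i) \<subseteq> L i"
      using projection_onto_span[OF i S(1)] S(2) LV sub by (meson order_trans)
    have "submodule class_ring {v \<in> carrier (V i). p v = v} (V i)"
    proof (rule submoduleI[OF i])
      show "\<zero>\<^bsub>V i\<^esub> \<in> {v \<in> carrier (V i). p v = v}"
        using i by (simp add: lhom_zero[OF i i p(1)])
    qed (use i p(1) in \<open>auto simp: lhomD\<close>)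
    moreover have "S \<subseteq> {v \<in> carrier (V i). p v = v}" using p(2) S(2) LV by auto
    ultimately have "L i \<subseteq> {v \<in> carrier (V i). p v = v}" using S(3) by simp
    then show ?thesis using p(1,3) by (intro bexI[of _ p]) auto
  qed
  then obtain p where "\<forall>i\<in>verts Q. p i \<in> lhom (V i) (V i) \<and> p i ` carrier (V i) \<subseteq> L i \<and> (\<forall>l\<in>L i. p i l = l)"
    by metis
  then show thesis by (intro that[of p]) (auto simp: graded_endo_def)
qed

lemma graded_endo_zero:
  "\<lbrakk>graded_endo T; i \<in> verts Q\<rbrakk> \<Longrightarrow> T i \<zero>\<^bsub>V i\<^esub> = \<zero>\<^bsub>V i\<^esub>"
  by (simp add: graded_endo_def lhom_zero)

lemmas endo_simps = graded_endo_closed graded_endo_add graded_endo_smult graded_endo_zero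

text \<open>
  Witt's correction. Take any graded projection \<open>p\<close> onto \<open>L\<close>, with adjoint \<open>p'\<close>. As \<open>L\<close> is isotropic,
  \<open>p' p = 0\<close>, but the image of \<open>p'\<close>, a complement of \<open>L\<^sup>\<bottom>\<close>, need not be isotropic; the obstruction is \<open>p p'\<close>.
  The operator \<open>p p'\<close> is self-adjoint, takes values in \<open>L\<close> and vanishes on \<open>L\<close>, so \<open>e = p - p p'/2\<close> is
  again a projection onto \<open>L\<close>, and \<open>e e' = p p' - p p'/2 - p p'/2 = 0\<close>.
\<close>

lemma isotropic_projection:
  assumes L: "\<And>i. i \<in> verts Q \<Longrightarrow> VectorSpace.subspace class_ring (L i) (V i)"
    and iso: "\<And>i j l m. \<lbrakk>i \<in> verts Q; j \<in> verts Q; l \<in> L i; m \<in> L j\<rbrakk> \<Longrightarrow> B i j l m = 0"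
  obtains e e' where "graded_endo e" "graded_endo e'" "adjoint e e'"
    "\<forall>i\<in>verts Q. \<forall>v\<in>carrier (V i). e i v \<in> L i"
    "\<forall>i\<in>verts Q. \<forall>l\<in>L i. e i l = l"
    "\<forall>i\<in>verts Q. \<forall>v\<in>carrier (V i). e i (e' i v) = \<zero>\<^bsub>V i\<^esub>"
proof -
  have LV: "l \<in> carrier (V i)" if "i \<in> verts Q" "l \<in> L i" for i l
    using L[OF that(1)] that(2) by (auto simp: VectorSpace.subspace_def dest: submodule.subset)
  obtain p where p: "graded_endo p"
    and p_in: "\<And>i v. i \<in> verts Q \<Longrightarrow> v \<in> carrier (V i) \<Longrightarrow> p i v \<in> L i"
    and p_id: "\<And>i l. i \<in> verts Q \<Longrightarrow> l \<in> L i \<Longrightarrow> p i l = l"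
    using graded_projection[of L, OF L] by metis
  obtain p' where p': "graded_endo p'" and adj: "adjoint p p'" using adjoint_exists[OF p] .
  have adj': "adjoint p' p" by (rule adjoint_sym[OF p p' adj])
  have p'_L: "p' i l = \<zero>\<^bsub>V i\<^esub>" if "i \<in> verts Q" "l \<in> L i" for i l
    by (rule V_eqI_right)
      (use that p p' in \<open>auto simp: endo_simps B_simps LV iso p_in simp flip: adjointD[OF adj]\<close>)
  have p'p': "p' i (p' i v) = p' i v" if "i \<in> verts Q" "v \<in> carrier (V i)" for i v
    by (rule V_eqI_right)
      (use that p p' in \<open>auto simp: endo_simps p_id p_in simp flip: adjointD[OF adj]\<close>)
  define e where "e i v = p i v \<oplus>\<^bsub>V i\<^esub> (-1/2) \<odot>\<^bsub>V i\<^esub> p i (p' i v)" for i v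
  define e' where "e' i v = p' i v \<oplus>\<^bsub>V i\<^esub> (-1/2) \<odot>\<^bsub>V i\<^esub> p i (p' i v)" for i v
  note simps = endo_simps[OF p] endo_simps[OF p'] B_simps p_id p_in p'_L p'p' LV
  have e: "graded_endo e" "graded_endo e'"
    unfolding graded_endo_def
    by (intro ballI lhomI; (rule V_eqI, assumption)?; simp add: simps e_def e'_def algebra_simps)+
  moreover have "adjoint e e'"
    unfolding adjoint_def
    by (intro ballI) (simp add: simps e_def e'_def adjointD[OF adj] adjointD[OF adj'])
  moreover have "e i v \<in> L i" if "i \<in> verts Q" "v \<in> carrier (V i)" for i v
  proof -
    have sub: "submodule class_ring (L i) (V i)"
      using L[OF that(1)] by (simp add: VectorSpace.subspace_def)
    show ?thesis using that
      by (auto simp: e_def simps intro!: submodule.m_closed[OF sub] submodule.smult_closed[OF sub])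
  qed
  moreover have "e i l = l" if "i \<in> verts Q" "l \<in> L i" for i l
    by (rule V_eqI) (use that in \<open>auto simp: simps e_def\<close>)
  moreover have "e i (e' i v) = \<zero>\<^bsub>V i\<^esub>" if "i \<in> verts Q" "v \<in> carrier (V i)" for i v
    by (rule V_eqI) (use that in \<open>auto simp: simps e_def e'_def\<close>)
  ultimately show thesis using that by simp
qed

end

section \<open>The one-parameter group attached to an isotropic subrepresentation\<close>

text \<open>
  A skew-adjoint \<open>M\<close> preserving an isotropic \<open>L\<close>, with a projection \<open>e\<close> and an adjoint \<open>e'\<close> as in
  \<open>isotropic_projection\<close>.
\<close>

locale isotropic_splitting = symmetric_quadratic_space Q sv sa \<epsilon> V B
  for Q :: "('v, 'e) pre_digraph" and sv sa \<epsilon> and V :: "'v \<Rightarrow> (complex, 'a) module" and B +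
  fixes M :: "'e \<Rightarrow> 'a \<Rightarrow> 'a" and L :: "'v \<Rightarrow> 'a set" and e e' :: "'v \<Rightarrow> 'a \<Rightarrow> 'a"
  assumes M_hom: "\<alpha> \<in> arcs Q \<Longrightarrow> M \<alpha> \<in> lhom (V (tail Q \<alpha>)) (V (head Q \<alpha>))"
    and M_skew: "\<lbrakk>\<alpha> \<in> arcs Q; v \<in> carrier (V (tail Q \<alpha>)); w \<in> carrier (V (sv (head Q \<alpha>)))\<rbrakk> \<Longrightarrow>
      B (head Q \<alpha>) (sv (head Q \<alpha>)) (M \<alpha> v) w + B (tail Q \<alpha>) (sv (tail Q \<alpha>)) v (M (sa \<alpha>) w) = 0"
    and M_L: "\<lbrakk>\<alpha> \<in> arcs Q; l \<in> L (tail Q \<alpha>)\<rbrakk> \<Longrightarrow> M \<alpha> l \<in> L (head Q \<alpha>)"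
    and L_sub: "i \<in> verts Q \<Longrightarrow> submodule class_ring (L i) (V i)"
    and L_iso: "\<lbrakk>i \<in> verts Q; j \<in> verts Q; l \<in> L i; m \<in> L j\<rbrakk> \<Longrightarrow> B i j l m = 0"
    and e: "graded_endo e" and e': "graded_endo e'" and adj: "adjoint e e'"
    and e_in: "\<lbrakk>i \<in> verts Q; v \<in> carrier (V i)\<rbrakk> \<Longrightarrow> e i v \<in> L i"
    and e_id: "\<lbrakk>i \<in> verts Q; l \<in> L i\<rbrakk> \<Longrightarrow> e i l = l"
    and e_e': "\<lbrakk>i \<in> verts Q; v \<in> carrier (V i)\<rbrakk> \<Longrightarrow> e i (e' i v) = \<zero>\<^bsub>V i\<^esub>"
begin

lemma adj': "adjoint e' e" by (rule adjoint_sym[OF e e' adj])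

lemma L_V: "\<lbrakk>i \<in> verts Q; l \<in> L i\<rbrakk> \<Longrightarrow> l \<in> carrier (V i)"
  using L_sub submodule.subset by blast

lemma L_closed:
  assumes "i \<in> verts Q" "l \<in> L i"
  shows L_add: "m \<in> L i \<Longrightarrow> l \<oplus>\<^bsub>V i\<^esub> m \<in> L i" and L_smult: "c \<odot>\<^bsub>V i\<^esub> l \<in> L i"
  using submodule.m_closed[OF L_sub] submodule.smult_closed[OF L_sub] assms by auto

lemma L_zero: "i \<in> verts Q \<Longrightarrow> \<zero>\<^bsub>V i\<^esub> \<in> L i"
  using submodule.zero_closed[OF L_sub] .

lemma e_e: "\<lbrakk>i \<in> verts Q; v \<in> carrier (V i)\<rbrakk> \<Longrightarrow> e i (e i v) = e i v"
  by (simp add: e_id e_in)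

lemma e'_L: "\<lbrakk>i \<in> verts Q; l \<in> L i\<rbrakk> \<Longrightarrow> e' i l = \<zero>\<^bsub>V i\<^esub>"
  by (rule V_eqI_right)
    (use e e' in \<open>auto simp: endo_simps B_simps L_V L_iso e_in simp flip: adjointD[OF adj]\<close>)

lemma e'_e: "\<lbrakk>i \<in> verts Q; v \<in> carrier (V i)\<rbrakk> \<Longrightarrow> e' i (e i v) = \<zero>\<^bsub>V i\<^esub>"
  by (simp add: e'_L e_in)

lemma e'_e': "\<lbrakk>i \<in> verts Q; v \<in> carrier (V i)\<rbrakk> \<Longrightarrow> e' i (e' i v) = e' i v"
  by (rule V_eqI_right) (use e e' in \<open>auto simp: endo_simps e_e simp flip: adjointD[OF adj]\<close>)

lemma M_closed: "\<lbrakk>\<alpha> \<in> arcs Q; v \<in> carrier (V (tail Q \<alpha>))\<rbrakk> \<Longrightarrow> M \<alpha> v \<in> carrier (V (head Q \<alpha>))"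
  using lhom_closed[OF M_hom] .

lemmas M_add = lhom_add[OF M_hom] and M_smult = lhom_smult[OF M_hom]

lemma M_skew_right:
  assumes \<alpha>: "\<alpha> \<in> arcs Q" and v: "v \<in> carrier (V (tail Q \<alpha>))"
    and w: "w \<in> carrier (V (sv (head Q \<alpha>)))"
  shows "B (sv (head Q \<alpha>)) (head Q \<alpha>) w (M \<alpha> v) = - B (sv (tail Q \<alpha>)) (tail Q \<alpha>) (M (sa \<alpha>) w) v"
proof -
  have w': "M (sa \<alpha>) w \<in> carrier (V (sv (tail Q \<alpha>)))"
    using M_closed[of "sa \<alpha>" w] \<alpha> w by (simp add: tail_sa head_sa)
  have "B (sv (head Q \<alpha>)) (head Q \<alpha>) w (M \<alpha> v) = \<epsilon> * B (head Q \<alpha>) (sv (head Q \<alpha>)) (M \<alpha> v) w"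
    using \<alpha> v w by (intro eps_symmetric) (auto simp: M_closed)
  also have "\<dots> = - (\<epsilon> * B (tail Q \<alpha>) (sv (tail Q \<alpha>)) v (M (sa \<alpha>) w))"
    using M_skew[OF assms] by (simp add: eq_neg_iff_add_eq_0 flip: distrib_left)
  also have "\<dots> = - B (sv (tail Q \<alpha>)) (tail Q \<alpha>) (M (sa \<alpha>) w) v"
    using \<alpha> v w' eps_symmetric[of "sv (tail Q \<alpha>)" "tail Q \<alpha>" "M (sa \<alpha>) w" v] by simp
  finally show ?thesis .
qed

lemma e_M_e: "\<lbrakk>\<alpha> \<in> arcs Q; v \<in> carrier (V (tail Q \<alpha>))\<rbrakk> \<Longrightarrow>
    e (head Q \<alpha>) (M \<alpha> (e (tail Q \<alpha>) v)) = M \<alpha> (e (tail Q \<alpha>) v)"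
  by (simp add: e_id M_L e_in)

lemma e'_M_e: "\<lbrakk>\<alpha> \<in> arcs Q; v \<in> carrier (V (tail Q \<alpha>))\<rbrakk> \<Longrightarrow>
    e' (head Q \<alpha>) (M \<alpha> (e (tail Q \<alpha>) v)) = \<zero>\<^bsub>V (head Q \<alpha>)\<^esub>"
  by (simp add: e'_L M_L e_in)

text \<open>
  The adjoint of \<open>e M e = M e\<close>, that is of the inclusion \<open>M L \<subseteq> L\<close>; it says that \<open>M\<close> preserves
  \<open>L\<^sup>\<bottom>\<close>, the kernel of \<open>e'\<close>.
\<close>

lemma e'_M:
  assumes \<alpha>: "\<alpha> \<in> arcs Q" and v: "v \<in> carrier (V (tail Q \<alpha>))"
  shows "e' (head Q \<alpha>) (M \<alpha> v) = e' (head Q \<alpha>) (M \<alpha> (e' (tail Q \<alpha>) v))"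
proof (rule V_eqI_right)
  fix j w assume j: "j \<in> verts Q" and w: "w \<in> carrier (V j)"
  have e'v: "e' (tail Q \<alpha>) v \<in> carrier (V (tail Q \<alpha>))" using \<alpha> v e' by (simp add: endo_simps)
  have ew: "e j w \<in> L j" "e j w \<in> carrier (V j)" using j w by (simp_all add: e_in L_V)
  have "B j (head Q \<alpha>) (e j w) (M \<alpha> v) = B j (head Q \<alpha>) (e j w) (M \<alpha> (e' (tail Q \<alpha>) v))"
  proof (cases "j = sv (head Q \<alpha>)")
    case True
    have "M (sa \<alpha>) (e j w) \<in> L (sv (tail Q \<alpha>))"
      using M_L[of "sa \<alpha>" "e j w"] \<alpha> ew True by (simp add: tail_sa head_sa)
    then have "B (sv (tail Q \<alpha>)) (tail Q \<alpha>) (M (sa \<alpha>) (e j w)) (e' (tail Q \<alpha>) v) =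
        B (sv (tail Q \<alpha>)) (tail Q \<alpha>) (M (sa \<alpha>) (e j w)) v"
      using \<alpha> v by (simp add: e_id L_V flip: adjointD[OF adj])
    then show ?thesis
      using M_skew_right[OF \<alpha> v, of "e j w"] M_skew_right[OF \<alpha> e'v, of "e j w"] ew True by simp
  next
    case False
    then have "head Q \<alpha> \<noteq> sv j" using j by auto
    then show ?thesis using graded[of j "head Q \<alpha>"] \<alpha> v e'v ew j by (simp add: M_closed)
  qed
  then show "B j (head Q \<alpha>) w (e' (head Q \<alpha>) (M \<alpha> v)) =
      B j (head Q \<alpha>) w (e' (head Q \<alpha>) (M \<alpha> (e' (tail Q \<alpha>) v)))"
    using j w \<alpha> v e'v by (simp add: M_closed flip: adjointD[OF adj])
qed (use \<alpha> v e' in \<open>simp_all add: endo_simps M_closed\<close>)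

text \<open>
  Multiplication by \<open>t\<close> on \<open>L\<close>, by \<open>t\<^sup>-\<^sup>1\<close> on the image of \<open>e'\<close> and by \<open>1\<close> on the common kernel of \<open>e\<close>
  and \<open>e'\<close>.
\<close>

definition torus :: "complex \<Rightarrow> 'v \<Rightarrow> 'a \<Rightarrow> 'a" where
  "torus t i v = v \<oplus>\<^bsub>V i\<^esub> ((t - 1) \<odot>\<^bsub>V i\<^esub> e i v \<oplus>\<^bsub>V i\<^esub> (1/t - 1) \<odot>\<^bsub>V i\<^esub> e' i v)"

text \<open>
  The block diagonal part \<open>e M e + h M h + e' M e'\<close> of \<open>M\<close>, where \<open>h = 1 - e - e'\<close>, expanded and
  simplified with \<open>e M e = M e\<close> and \<open>e' M = e' M e'\<close>.
\<close>

definition gr :: "'e \<Rightarrow> 'a \<Rightarrow> 'a" where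
  "gr \<alpha> v = (let i = tail Q \<alpha>; j = head Q \<alpha> in
     (M \<alpha> v \<oplus>\<^bsub>V j\<^esub> (-1) \<odot>\<^bsub>V j\<^esub> (e j (M \<alpha> v) \<oplus>\<^bsub>V j\<^esub> M \<alpha> (e' i v))) \<oplus>\<^bsub>V j\<^esub>
     (e j (M \<alpha> (e' i v)) \<oplus>\<^bsub>V j\<^esub> (e' j (M \<alpha> (e' i v)) \<oplus>\<^bsub>V j\<^esub> M \<alpha> (e i v))))"

lemmas ee_simps = endo_simps[OF e] endo_simps[OF e'] e_e e'_e e_e' e'_e'

lemma torus_endo: "graded_endo (torus t)"
  unfolding graded_endo_def
  by (intro ballI lhomI; (rule V_eqI, assumption)?; simp add: torus_def ee_simps B_simps algebra_simps)

lemma torus_isometric: "t \<noteq> 0 \<Longrightarrow> isometric (torus t)"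
  unfolding isometric_def
  by (intro ballI)
    (simp add: torus_def ee_simps B_simps adjointD[OF adj] adjointD[OF adj'] field_simps)

lemma torus_inverse:
  assumes "t \<noteq> 0" "i \<in> verts Q" "v \<in> carrier (V i)"
  shows "torus t i (torus (1/t) i v) = v"
  by (rule V_eqI[OF assms(2)]) (use assms in \<open>simp_all add: torus_def ee_simps B_simps field_simps\<close>)

lemma gr_closed: "\<lbrakk>\<alpha> \<in> arcs Q; v \<in> carrier (V (tail Q \<alpha>))\<rbrakk> \<Longrightarrow> gr \<alpha> v \<in> carrier (V (head Q \<alpha>))"
  by (simp add: gr_def Let_def ee_simps M_closed)

text \<open>
  In \<open>\<lambda>(t) M \<lambda>(1/t)\<close> the negative powers of \<open>t\<close> occur only with \<open>M e\<close> and \<open>e' M\<close>. There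
  \<open>e M e = M e\<close> and \<open>e' M = e' M e'\<close> supply a factor \<open>t\<close> that cancels them:
  \<open>(1/t - 1) + (t - 1) (1/t - 1) = 1 - t\<close>.
\<close>

lemma torus_conjugate_polynomial:
  assumes \<alpha>: "\<alpha> \<in> arcs Q" and v: "v \<in> carrier (V (tail Q \<alpha>))"
    and f: "f \<in> lhom (V (head Q \<alpha>)) scalar_space"
  shows "\<exists>q. poly q 0 = f (gr \<alpha> v) \<and>
    (\<forall>t. t \<noteq> 0 \<longrightarrow> poly q t = f (torus t (head Q \<alpha>) (M \<alpha> (torus (1/t) (tail Q \<alpha>) v))))"
proof -
  let ?i = "tail Q \<alpha>" and ?j = "head Q \<alpha>"
  define a b c d r k where "a = f (M \<alpha> v)" and "b = f (e ?j (M \<alpha> v))" and "c = f (M \<alpha> (e' ?i v))"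
    and "d = f (e ?j (M \<alpha> (e' ?i v)))" and "r = f (e' ?j (M \<alpha> (e' ?i v)))"
    and "k = f (M \<alpha> (e ?i v))"
  note defs = a_def b_def c_def d_def r_def k_def
  \<comment> \<open>the expansion of \<open>\<lambda>(t) M \<lambda>(1/t)\<close> by powers of \<open>t\<close>, with the cancellations carried out\<close>
  define q where "q = [:a - b - c + d + r + k, b + c - 2 * d - r - k, d:]"
  note simps = ee_simps M_closed M_add M_smult functional_add[OF f] functional_smult[OF f]
    e_M_e e'_M_e e'_M[OF \<alpha> v]
  have "f (gr \<alpha> v) = a - b - c + d + r + k"
    using \<alpha> v by (simp add: gr_def Let_def simps defs)
  moreover have "f (torus t ?j (M \<alpha> (torus (1/t) ?i v))) = poly q t" if t: "t \<noteq> 0" for t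
  proof -
    have "f (torus t ?j (M \<alpha> (torus (1/t) ?i v))) =
        a + (t - 1) * b + (1/t - 1) * r
        + (t - 1) * (c + (t - 1) * d + (1/t - 1) * r)
        + (1/t - 1) * (k + (t - 1) * k)"
      using \<alpha> v t functional_zero[OF _ f] by (simp add: torus_def simps field_simps defs)
    also have "\<dots> = poly q t" using t by (simp add: q_def field_simps)
    finally show ?thesis .
  qed
  ultimately show ?thesis by (intro exI[of _ q]) (simp add: q_def)
qed

section \<open>The associated graded representation\<close>

lemma coset_mem: "x \<in> L i +>\<^bsub>V i\<^esub> a \<longleftrightarrow> (\<exists>l\<in>L i. x = l \<oplus>\<^bsub>V i\<^esub> a)"
  by (auto simp: a_r_coset_def')

lemma coset_carrier_update:
  "L i +>\<^bsub>V i\<lparr>carrier := C\<rparr>\<^esub> a = L i +>\<^bsub>V i\<^esub> a"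
  by (simp add: a_r_coset_def')

lemma coset_absorb:
  assumes i: "i \<in> verts Q" and l: "l \<in> L i" and a: "a \<in> carrier (V i)"
  shows "L i +>\<^bsub>V i\<^esub> (l \<oplus>\<^bsub>V i\<^esub> a) = L i +>\<^bsub>V i\<^esub> a"
proof (intro Set.set_eqI iffI)
  fix x assume "x \<in> L i +>\<^bsub>V i\<^esub> (l \<oplus>\<^bsub>V i\<^esub> a)"
  then obtain m where m: "m \<in> L i" "x = m \<oplus>\<^bsub>V i\<^esub> (l \<oplus>\<^bsub>V i\<^esub> a)" by (auto simp: coset_mem)
  have "x = (m \<oplus>\<^bsub>V i\<^esub> l) \<oplus>\<^bsub>V i\<^esub> a"
    by (rule V_eqI[OF i]) (use m i l a in \<open>simp_all add: L_V B_simps\<close>)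
  then show "x \<in> L i +>\<^bsub>V i\<^esub> a" using m i l by (auto simp: coset_mem L_add)
next
  fix x assume "x \<in> L i +>\<^bsub>V i\<^esub> a"
  then obtain m where m: "m \<in> L i" "x = m \<oplus>\<^bsub>V i\<^esub> a" by (auto simp: coset_mem)
  have "x = (m \<oplus>\<^bsub>V i\<^esub> (-1) \<odot>\<^bsub>V i\<^esub> l) \<oplus>\<^bsub>V i\<^esub> (l \<oplus>\<^bsub>V i\<^esub> a)"
    by (rule V_eqI[OF i]) (use m i l a in \<open>simp_all add: L_V B_simps\<close>)
  moreover have "m \<oplus>\<^bsub>V i\<^esub> (-1) \<odot>\<^bsub>V i\<^esub> l \<in> L i" using m i l by (simp add: L_add L_smult)
  ultimately show "x \<in> L i +>\<^bsub>V i\<^esub> (l \<oplus>\<^bsub>V i\<^esub> a)" by (auto simp: coset_mem)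
qed

lemma coset_eqI:
  assumes i: "i \<in> verts Q" and a: "a \<in> carrier (V i)" and b: "b \<in> carrier (V i)"
    and l: "a \<oplus>\<^bsub>V i\<^esub> (-1) \<odot>\<^bsub>V i\<^esub> b \<in> L i"
  shows "L i +>\<^bsub>V i\<^esub> a = L i +>\<^bsub>V i\<^esub> b"
proof -
  have "a = (a \<oplus>\<^bsub>V i\<^esub> (-1) \<odot>\<^bsub>V i\<^esub> b) \<oplus>\<^bsub>V i\<^esub> b"
    by (rule V_eqI[OF i]) (use i a b in \<open>simp_all add: B_simps\<close>)
  then show ?thesis using coset_absorb[OF i l b] by metis
qed

lemma coset_add:
  assumes i: "i \<in> verts Q" and a: "a \<in> carrier (V i)" and b: "b \<in> carrier (V i)"
  shows "set_add (V i\<lparr>carrier := C\<rparr>) (L i +>\<^bsub>V i\<^esub> a) (L i +>\<^bsub>V i\<^esub> b) = L i +>\<^bsub>V i\<^esub> (a \<oplus>\<^bsub>V i\<^esub> b)"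
proof (intro Set.set_eqI iffI)
  fix x assume "x \<in> set_add (V i\<lparr>carrier := C\<rparr>) (L i +>\<^bsub>V i\<^esub> a) (L i +>\<^bsub>V i\<^esub> b)"
  then obtain l m where lm: "l \<in> L i" "m \<in> L i"
    "x = (l \<oplus>\<^bsub>V i\<^esub> a) \<oplus>\<^bsub>V i\<^esub> (m \<oplus>\<^bsub>V i\<^esub> b)" by (auto simp: set_add_def' coset_mem)
  have "x = (l \<oplus>\<^bsub>V i\<^esub> m) \<oplus>\<^bsub>V i\<^esub> (a \<oplus>\<^bsub>V i\<^esub> b)"
    by (rule V_eqI[OF i]) (use lm i a b in \<open>simp_all add: L_V B_simps\<close>)
  then show "x \<in> L i +>\<^bsub>V i\<^esub> (a \<oplus>\<^bsub>V i\<^esub> b)" using lm i by (auto simp: coset_mem L_add)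
next
  fix x assume "x \<in> L i +>\<^bsub>V i\<^esub> (a \<oplus>\<^bsub>V i\<^esub> b)"
  then obtain l where l: "l \<in> L i" "x = l \<oplus>\<^bsub>V i\<^esub> (a \<oplus>\<^bsub>V i\<^esub> b)" by (auto simp: coset_mem)
  have "x = (l \<oplus>\<^bsub>V i\<^esub> a) \<oplus>\<^bsub>V i\<^esub> (\<zero>\<^bsub>V i\<^esub> \<oplus>\<^bsub>V i\<^esub> b)"
    by (rule V_eqI[OF i]) (use l i a b in \<open>simp_all add: L_V B_simps\<close>)
  moreover have "l \<oplus>\<^bsub>V i\<^esub> a \<in> L i +>\<^bsub>V i\<^esub> a" "\<zero>\<^bsub>V i\<^esub> \<oplus>\<^bsub>V i\<^esub> b \<in> L i +>\<^bsub>V i\<^esub> b"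
    using l(1) L_zero[OF i] by (auto simp: coset_mem)
  ultimately show "x \<in> set_add (V i\<lparr>carrier := C\<rparr>) (L i +>\<^bsub>V i\<^esub> a) (L i +>\<^bsub>V i\<^esub> b)"
    by (simp only: set_add_def') auto
qed

lemma coset_UN_eq:
  assumes "i \<in> verts Q" "\<And>l. l \<in> L i \<Longrightarrow> F (l \<oplus>\<^bsub>V i\<^esub> a) = C"
  shows "(\<Union>x\<in>L i +>\<^bsub>V i\<^esub> a. F x) = C"
proof -
  have "(\<Union>x\<in>L i +>\<^bsub>V i\<^esub> a. F x) = (\<Union>l\<in>L i. F (l \<oplus>\<^bsub>V i\<^esub> a))" by (simp add: a_r_coset_def')
  also have "\<dots> = C" using assms(2) L_zero[OF assms(1)] by auto
  finally show ?thesis .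
qed

text \<open>
  The projection onto \<open>L\<^sup>\<bottom>\<close> with kernel the image of \<open>e'\<close>.
\<close>

definition perp_part :: "'v \<Rightarrow> 'a \<Rightarrow> 'a" where
  "perp_part i v = v \<oplus>\<^bsub>V i\<^esub> (-1) \<odot>\<^bsub>V i\<^esub> e' i v"

lemma perp_part_closed: "\<lbrakk>i \<in> verts Q; v \<in> carrier (V i)\<rbrakk> \<Longrightarrow> perp_part i v \<in> carrier (V i)"
  by (simp add: perp_part_def ee_simps)

lemma B_perp_part_L:
  assumes "i \<in> verts Q" "v \<in> carrier (V i)" "j \<in> verts Q" "l \<in> L j"
  shows "B i j (perp_part i v) l = 0" "B j i l (perp_part i v) = 0"
proof -
  have "B i j (e' i v) l = B i j v l"
    using assms by (simp add: adjointD[OF adj'] L_V e_id)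
  then show "B i j (perp_part i v) l = 0"
    using assms by (simp add: perp_part_def ee_simps B_simps L_V)
  then show "B j i l (perp_part i v) = 0"
    using assms by (simp add: eps_symmetric[of j i] L_V perp_part_closed)
qed

lemma perp_part_in_perp: "\<lbrakk>i \<in> verts Q; v \<in> carrier (V i)\<rbrakk> \<Longrightarrow> perp_part i v \<in> perp Q V B L i"
  by (simp add: perp_def perp_part_closed B_perp_part_L)

abbreviation degeneration_rep where
  "degeneration_rep \<equiv> form_rep_sum (hyperbolic_rep Q sv sa \<epsilon> (\<lambda>j. V j\<lparr>carrier := L j\<rparr>) M)
     (perp_quotient_rep Q V B M L)"

text \<open>
  In the decomposition given by \<open>e\<close> and \<open>e'\<close>: the \<open>L\<close>-part of \<open>v\<close>, its \<open>e'\<close>-part seen through the pairing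
  with \<open>L\<close>, and its remaining part modulo \<open>L\<close>. It is a bijection, but this needs no separate
  proof: a linear map compatible with non-degenerate forms is injective, and a count of dimensions makes
  the induced endomorphism of \<open>V\<close> bijective.
\<close>

definition to_degeneration :: "'v \<Rightarrow> 'a \<Rightarrow> ('a \<times> ('a \<Rightarrow> complex)) \<times> 'a set" where
  "to_degeneration i v =
     ((e i v, \<lambda>l\<in>L (sv i). B (sv i) i l v), L i +>\<^bsub>V i\<^esub> perp_part i v)"

lemmas degeneration_rep_defs = form_rep_sum_def hyperbolic_rep_def perp_quotient_rep_def
  direct_sum_def nabla_comp_def dual_space_def quot_space_def ring.func_space_def[OF class_ring.ring_axioms]

lemma to_degeneration_hom:
  assumes i: "i \<in> verts Q"
  shows "to_degeneration i \<in> lhom (V i) (component degeneration_rep i)"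
proof (rule lhomI)
  fix v assume v: "v \<in> carrier (V i)"
  have "(\<lambda>l\<in>L (sv i). B (sv i) i l v) \<in> lin_maps (V (sv i)\<lparr>carrier := L (sv i)\<rparr>) scalar_space"
    using i v by (auto simp: lin_maps_def L_add L_smult L_V B_simps intro!: functionalI)
  moreover have "L i +>\<^bsub>V i\<^esub> perp_part i v \<in> a_rcosets\<^bsub>V i\<lparr>carrier := perp Q V B L i\<rparr>\<^esub> L i"
    using perp_part_in_perp[OF i v] by (auto simp: A_RCOSETS_def' coset_carrier_update)
  ultimately show "to_degeneration i v \<in> carrier (component degeneration_rep i)"
    using i v by (simp add: degeneration_rep_defs to_degeneration_def e_in)
next
  fix v w assume v: "v \<in> carrier (V i)" "w \<in> carrier (V i)"
  have "perp_part i (v \<oplus>\<^bsub>V i\<^esub> w) = perp_part i v \<oplus>\<^bsub>V i\<^esub> perp_part i w"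
    by (rule V_eqI[OF i]) (use i v in \<open>simp_all add: perp_part_def ee_simps B_simps\<close>)
  then show "to_degeneration i (v \<oplus>\<^bsub>V i\<^esub> w) =
      to_degeneration i v \<oplus>\<^bsub>component degeneration_rep i\<^esub> to_degeneration i w"
    using i v by (auto simp: degeneration_rep_defs to_degeneration_def ee_simps coset_add
        perp_part_closed B_simps L_V intro!: restrict_ext)
next
  fix c v assume v: "v \<in> carrier (V i)"
  have *: "perp_part i (c \<odot>\<^bsub>V i\<^esub> v) = c \<odot>\<^bsub>V i\<^esub> perp_part i v"
    by (rule V_eqI[OF i]) (use i v in \<open>simp_all add: perp_part_def ee_simps B_simps algebra_simps\<close>)
  have "(\<Union>x\<in>L i +>\<^bsub>V i\<^esub> perp_part i v. L i +>\<^bsub>V i\<^esub> (c \<odot>\<^bsub>V i\<^esub> x)) =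
      L i +>\<^bsub>V i\<^esub> (c \<odot>\<^bsub>V i\<^esub> perp_part i v)"
  proof (rule coset_UN_eq[OF i])
    fix l assume l: "l \<in> L i"
    have "c \<odot>\<^bsub>V i\<^esub> (l \<oplus>\<^bsub>V i\<^esub> perp_part i v) = c \<odot>\<^bsub>V i\<^esub> l \<oplus>\<^bsub>V i\<^esub> c \<odot>\<^bsub>V i\<^esub> perp_part i v"
      by (rule V_eqI[OF i])
        (use i l v in \<open>simp_all add: L_V perp_part_closed B_simps algebra_simps\<close>)
    then show "L i +>\<^bsub>V i\<^esub> (c \<odot>\<^bsub>V i\<^esub> (l \<oplus>\<^bsub>V i\<^esub> perp_part i v)) =
        L i +>\<^bsub>V i\<^esub> (c \<odot>\<^bsub>V i\<^esub> perp_part i v)"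
      using i l v by (simp add: coset_absorb L_smult perp_part_closed)
  qed
  then show "to_degeneration i (c \<odot>\<^bsub>V i\<^esub> v) =
      c \<odot>\<^bsub>component degeneration_rep i\<^esub> to_degeneration i v"
    using i v by (auto simp: degeneration_rep_defs to_degeneration_def ee_simps coset_carrier_update *
        B_simps L_V intro!: restrict_ext)
qed

text \<open>
  The part in \<open>L\<^sup>\<bottom>/L\<close> contributes \<open>\<langle>v, w\<rangle> - \<langle>e v, w\<rangle> - \<langle>v, e w\<rangle>\<close>, and the hyperbolic part
  restores the two missing terms.
\<close>

lemma to_degeneration_form:
  assumes ij: "i \<in> verts Q" "j \<in> verts Q" and v: "v \<in> carrier (V i)" and w: "w \<in> carrier (V j)"
  shows "form degeneration_rep i j (to_degeneration i v) (to_degeneration j w) = B i j v w"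
proof -
  let ?X = "L i +>\<^bsub>V i\<^esub> perp_part i v" and ?Y = "L j +>\<^bsub>V j\<^esub> perp_part j w"
  let ?c = "B i j (perp_part i v) (perp_part j w)"
  have "B i j x y = ?c" if "x \<in> ?X" "y \<in> ?Y" for x y
    using that ij v w
    by (auto simp: coset_mem B_simps L_V perp_part_closed B_perp_part_L L_iso)
  moreover have "\<exists>x. x \<in> ?X" "\<exists>y. y \<in> ?Y"
    using L_zero ij by (auto simp: coset_mem)
  ultimately have "(\<lambda>(x, y). B i j x y) ` (?X \<times> ?Y) = {?c}" by (auto simp: image_iff)
  then have form: "form (perp_quotient_rep Q V B M L) i j ?X ?Y = ?c"
    by (simp add: perp_quotient_rep_def)
  have c: "?c = B i j v w - B i j (e i v) w - B i j v (e j w)"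
    using ij v w
    by (simp add: perp_part_def ee_simps B_simps adjointD[OF adj] adjointD[OF adj'] B_zero_right)
  show ?thesis
  proof (cases "j = sv i")
    case True
    have "\<epsilon> * B j i (e j w) v = B i j v (e j w)"
      using ij v w eps_symmetric[of i j v "e j w"] by (simp add: ee_simps)
    then show ?thesis using True ij v w form c
      by (auto simp: form_rep_sum_def to_degeneration_def hyperbolic_rep_def e_in)
  next
    case False
    then show ?thesis using ij v w form graded[OF ij False]
      by (simp add: form_rep_sum_def to_degeneration_def hyperbolic_rep_def perp_part_closed)
  qed
qed

text \<open>
  Componentwise: \<open>e gr M = M e\<close> is the map of \<open>L\<close>; \<open>e' gr M = e' M\<close> says that \<open>gr M v\<close> and \<open>M v\<close>
  pair equally with \<open>L\<close>, where skew-adjointness of \<open>M\<close> turns \<open>M\<close> into the map of \<open>\<nabla>L\<close>; and modulo \<open>L\<close>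
  the maps \<open>M\<close> and \<open>gr M\<close> agree on \<open>L\<^sup>\<bottom>\<close>.
\<close>

lemma to_degeneration_gr:
  assumes \<alpha>: "\<alpha> \<in> arcs Q" and v: "v \<in> carrier (V (tail Q \<alpha>))"
  shows "amap degeneration_rep \<alpha> (to_degeneration (tail Q \<alpha>) v) = to_degeneration (head Q \<alpha>) (gr \<alpha> v)"
proof -
  let ?i = "tail Q \<alpha>" and ?j = "head Q \<alpha>"
  have ij: "?i \<in> verts Q" "?j \<in> verts Q" using \<alpha> by simp_all
  note simps = ee_simps M_closed M_add M_smult e_M_e e'_M_e e'_M[OF \<alpha> v]
  have e_gr: "e ?j (gr \<alpha> v) = M \<alpha> (e ?i v)"
    by (rule V_eqI[OF ij(2)]) (use \<alpha> v in \<open>simp_all add: gr_def Let_def simps B_simps\<close>)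
  have e'_gr: "e' ?j (gr \<alpha> v) = e' ?j (M \<alpha> v)"
    by (rule V_eqI[OF ij(2)]) (use \<alpha> v in \<open>simp_all add: gr_def Let_def simps B_simps\<close>)
  have pairing: "- B (sv ?i) ?i (M (sa \<alpha>) l) v = B (sv ?j) ?j l (gr \<alpha> v)" if l: "l \<in> L (sv ?j)" for l
  proof -
    have "B (sv ?j) ?j l (gr \<alpha> v) = B (sv ?j) ?j (e (sv ?j) l) (gr \<alpha> v)"
      using l ij by (simp add: e_id)
    also have "\<dots> = B (sv ?j) ?j (e (sv ?j) l) (M \<alpha> v)"
      using l ij \<alpha> v by (simp only: adjointD[OF adj] e'_gr gr_closed M_closed sv_verts L_V)
    also have "\<dots> = - B (sv ?i) ?i (M (sa \<alpha>) l) v"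
      using l ij M_skew_right[OF \<alpha> v, of l] by (simp add: e_id L_V)
    finally show ?thesis by simp
  qed
  have nabla: "nabla_map Q sa (\<lambda>j. V j\<lparr>carrier := L j\<rparr>) M \<alpha> (\<lambda>l\<in>L (sv ?i). B (sv ?i) ?i l v) =
      (\<lambda>l\<in>L (sv ?j). B (sv ?j) ?j l (gr \<alpha> v))"
    using \<alpha> M_L[of "sa \<alpha>"] pairing
    by (auto simp: nabla_map_def tail_sa head_sa intro!: restrict_ext)
  have "(\<Union>x\<in>L ?i +>\<^bsub>V ?i\<^esub> perp_part ?i v. L ?j +>\<^bsub>V ?j\<^esub> M \<alpha> x) = L ?j +>\<^bsub>V ?j\<^esub> M \<alpha> (perp_part ?i v)"
    by (rule coset_UN_eq[OF ij(1)])
      (use \<alpha> ij v in \<open>simp add: M_add L_V perp_part_closed coset_absorb M_L M_closed\<close>)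
  also have "\<dots> = L ?j +>\<^bsub>V ?j\<^esub> perp_part ?j (gr \<alpha> v)"
  proof (rule coset_eqI[OF ij(2)])
    have "M \<alpha> (perp_part ?i v) \<oplus>\<^bsub>V ?j\<^esub> (-1) \<odot>\<^bsub>V ?j\<^esub> perp_part ?j (gr \<alpha> v) =
        (e ?j (M \<alpha> v) \<oplus>\<^bsub>V ?j\<^esub> (-1) \<odot>\<^bsub>V ?j\<^esub> e ?j (M \<alpha> (e' ?i v))) \<oplus>\<^bsub>V ?j\<^esub> (-1) \<odot>\<^bsub>V ?j\<^esub> M \<alpha> (e ?i v)"
      unfolding perp_part_def e'_gr
      by (rule V_eqI[OF ij(2)]) (use \<alpha> v in \<open>simp_all add: gr_def Let_def simps B_simps\<close>)
    also have "\<dots> \<in> L ?j"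
      using \<alpha> v ij by (intro L_add L_smult) (simp_all add: e_in M_closed ee_simps M_L)
    finally show "M \<alpha> (perp_part ?i v) \<oplus>\<^bsub>V ?j\<^esub> (-1) \<odot>\<^bsub>V ?j\<^esub> perp_part ?j (gr \<alpha> v) \<in> L ?j" .
  qed (use \<alpha> v ij in \<open>simp_all add: perp_part_closed M_closed gr_closed\<close>)
  finally show ?thesis
    by (simp add: form_rep_sum_def hyperbolic_rep_def perp_quotient_rep_def to_degeneration_def nabla e_gr)
qed

end

section \<open>Orbit closures\<close>

lemma complex_poly_eq_0_if_vanishing_off_0:
  fixes q :: "complex poly"
  assumes "\<And>t. t \<noteq> 0 \<Longrightarrow> poly q t = 0"
  shows "q = 0"
proof (rule ccontr)
  assume "q \<noteq> 0"
  then have "finite {t. poly q t = 0}" by (rule poly_roots_finite)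
  moreover have "UNIV - {0} \<subseteq> {t. poly q t = 0}" using assms by auto
  ultimately have "finite (UNIV - {0 :: complex})" by (rule finite_subset[rotated])
  then show False using infinite_UNIV_char_0[where 'a = complex] by simp
qed

text \<open>
  It suffices to know that the matrix coefficients are polynomial in \<open>t\<close>, as they generate the
  polynomial functions. The curve \<open>C\<close> is only meaningful for \<open>t \<noteq> 0\<close>, and \<open>N\<close> is its limit.
\<close>

lemma polynomial_along_curve:
  assumes P: "P \<in> polynomial_functions Q V"
    and curve: "\<And>\<alpha> v f. \<lbrakk>\<alpha> \<in> arcs Q; v \<in> carrier (V (tail Q \<alpha>)); f \<in> lin_maps (V (head Q \<alpha>)) scalar_space\<rbrakk>
      \<Longrightarrow> \<exists>q. poly q 0 = f (N \<alpha> v) \<and> (\<forall>t. t \<noteq> 0 \<longrightarrow> poly q t = f (C t \<alpha> v))"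
  shows "\<exists>q. poly q (0 :: complex) = P N \<and> (\<forall>t. t \<noteq> 0 \<longrightarrow> poly q t = P (C t))"
  using P
proof induction
  case (const c)
  show ?case by (rule exI[of _ "[:c:]"]) simp
next
  case (coeff \<alpha> v f)
  then show ?case by (rule curve)
next
  case (add P P')
  then obtain q q' where "poly q 0 = P N \<and> (\<forall>t. t \<noteq> 0 \<longrightarrow> poly q t = P (C t))"
    "poly q' 0 = P' N \<and> (\<forall>t. t \<noteq> 0 \<longrightarrow> poly q' t = P' (C t))" by blast
  then show ?case by (intro exI[of _ "q + q'"]) simp
next
  case (mult P P')
  then obtain q q' where "poly q 0 = P N \<and> (\<forall>t. t \<noteq> 0 \<longrightarrow> poly q t = P (C t))"
    "poly q' 0 = P' N \<and> (\<forall>t. t \<noteq> 0 \<longrightarrow> poly q' t = P' (C t))" by blast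
  then show ?case by (intro exI[of _ "q * q'"]) simp
qed

context symmetric_quadratic_space
begin

text \<open>
  Bijectivity of an isometric endomorphism is automatic: non-degeneracy makes it injective.
\<close>

lemma isometries_iff:
  "g \<in> isometries Q V B \<longleftrightarrow> graded_endo g \<and> isometric g \<and>
     g \<in> (\<Pi>\<^sub>E i\<in>verts Q. extensional (carrier (V i)))"
proof (intro iffI conjI)
  assume "g \<in> isometries Q V B"
  then show "graded_endo g" "isometric g" "g \<in> (\<Pi>\<^sub>E i\<in>verts Q. extensional (carrier (V i)))"
    by (auto simp: isometries_def graded_endo_def isometric_def lin_maps_def PiE_def Pi_def)
next
  assume g: "graded_endo g \<and> isometric g \<and> g \<in> (\<Pi>\<^sub>E i\<in>verts Q. extensional (carrier (V i)))"
  have "bij_betw (g i) (carrier (V i)) (carrier (V i))" if i: "i \<in> verts Q" for i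
  proof -
    have inj: "inj_on (g i) (carrier (V i))"
    proof (rule inj_onI)
      fix x y assume xy: "x \<in> carrier (V i)" "y \<in> carrier (V i)" "g i x = g i y"
      show "x = y"
      proof (rule V_eqI[OF i xy(1,2)])
        fix j w assume "j \<in> verts Q" "w \<in> carrier (V j)"
        then show "B i j x w = B i j y w"
          using g i xy unfolding isometric_def by metis
      qed
    qed
    have "linear_map class_ring (V i) (V i) (g i)"
      using g i vectorspace[OF i] V_module[OF i]
      by (simp add: linear_map_def mod_hom_def mod_hom_axioms_def graded_endo_def)
    from injective_endomorphism_surj[OF this fin_dim[OF i] inj] inj show ?thesis
      by (simp add: bij_betw_def)
  qed
  then show "g \<in> isometries Q V B"
    using g by (auto simp: isometries_def graded_endo_def isometric_def lin_maps_def PiE_def Pi_def)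
qed

definition restrict_endo :: "('v \<Rightarrow> 'a \<Rightarrow> 'a) \<Rightarrow> 'v \<Rightarrow> 'a \<Rightarrow> 'a" where
  "restrict_endo g = (\<lambda>i\<in>verts Q. restrict (g i) (carrier (V i)))"

lemma restrict_endo_apply [simp]:
  "\<lbrakk>i \<in> verts Q; v \<in> carrier (V i)\<rbrakk> \<Longrightarrow> restrict_endo g i v = g i v"
  by (simp add: restrict_endo_def)

lemma restrict_endo_isometry:
  assumes "graded_endo g" "isometric g"
  shows "restrict_endo g \<in> isometries Q V B"
  unfolding isometries_iff
proof (intro conjI)
  show "graded_endo (restrict_endo g)"
    unfolding graded_endo_def by (intro ballI lhomI) (use assms(1) in \<open>simp_all add: endo_simps\<close>)
  show "isometric (restrict_endo g)"
    using assms unfolding isometric_def by simp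
qed (auto simp: restrict_endo_def)

lemma group_act_apply:
  assumes g: "g \<in> isometries Q V B" and \<alpha>: "\<alpha> \<in> arcs Q" and v: "v \<in> carrier (V (tail Q \<alpha>))"
  shows "group_act Q V g M \<alpha> (g (tail Q \<alpha>) v) = g (head Q \<alpha>) (M \<alpha> v)"
proof -
  have "bij_betw (g (tail Q \<alpha>)) (carrier (V (tail Q \<alpha>))) (carrier (V (tail Q \<alpha>)))"
    using g \<alpha> by (simp add: isometries_def)
  then show ?thesis using \<alpha> v by (auto simp: group_act_def bij_betw_def)
qed

lemma isometry_preimage:
  assumes "g \<in> isometries Q V B" "i \<in> verts Q" "v \<in> carrier (V i)"
  obtains u where "u \<in> carrier (V i)" "v = g i u"
proof -
  have "v \<in> g i ` carrier (V i)" using assms by (simp add: isometries_def bij_betw_def)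
  then show thesis using that by blast
qed

text \<open>
  \<open>N\<close> lies in the closure of the orbit of \<open>M\<close> inside the affine space of all tuples of linear maps. Unlike
  closure in \<open>rep_variety\<close>, this needs no verification that the orbit satisfies the relations.
\<close>

definition orbit_specializes :: "('e \<Rightarrow> 'a \<Rightarrow> 'a) \<Rightarrow> ('e \<Rightarrow> 'a \<Rightarrow> 'a) \<Rightarrow> bool" where
  "orbit_specializes M N \<longleftrightarrow> (\<forall>P\<in>polynomial_functions Q V.
     (\<forall>g\<in>isometries Q V B. P (group_act Q V g M) = 0) \<longrightarrow> P N = 0)"

definition arrow_maps :: "('e \<Rightarrow> 'a \<Rightarrow> 'a) set" where
  "arrow_maps = {M. \<forall>\<alpha>\<in>arcs Q. \<forall>v\<in>carrier (V (tail Q \<alpha>)). M \<alpha> v \<in> carrier (V (head Q \<alpha>))}"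

lemma arrow_mapsD:
  "\<lbrakk>M \<in> arrow_maps; \<alpha> \<in> arcs Q; v \<in> carrier (V (tail Q \<alpha>))\<rbrakk> \<Longrightarrow> M \<alpha> v \<in> carrier (V (head Q \<alpha>))"
  by (simp add: arrow_maps_def)

lemma eps_reps_lhom:
  "\<lbrakk>M \<in> eps_reps Q sv sa I V B; \<alpha> \<in> arcs Q\<rbrakk> \<Longrightarrow> M \<alpha> \<in> lhom (V (tail Q \<alpha>)) (V (head Q \<alpha>))"
  by (auto simp: eps_reps_def rep_variety_def intro: lin_maps_imp_lhom)

lemma eps_reps_arrow_maps: "M \<in> eps_reps Q sv sa I V B \<Longrightarrow> M \<in> arrow_maps"
  by (auto simp: arrow_maps_def intro: lhom_closed[OF eps_reps_lhom])

lemma group_act_arrow_maps: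
  assumes "g \<in> isometries Q V B" "M \<in> arrow_maps"
  shows "group_act Q V g M \<in> arrow_maps"
  unfolding arrow_maps_def
proof (intro CollectI ballI)
  fix \<alpha> v assume \<alpha>: "\<alpha> \<in> arcs Q" and v: "v \<in> carrier (V (tail Q \<alpha>))"
  obtain u where u: "u \<in> carrier (V (tail Q \<alpha>))" "v = g (tail Q \<alpha>) u"
    using isometry_preimage[OF assms(1) _ v] \<alpha> by auto
  then show "group_act Q V g M \<alpha> v \<in> carrier (V (head Q \<alpha>))"
    using assms \<alpha> by (simp add: group_act_apply arrow_mapsD isometries_iff endo_simps)
qed

text \<open>
  A coefficient \<open>f ((g \<cdot> M) \<alpha> v)\<close> is the coefficient of \<open>M\<close> at \<open>f \<circ> g\<close> and \<open>g\<^sup>-\<^sup>1 v\<close>. The tuples have to map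
  carriers to carriers, because functionals in \<open>lin_maps\<close> are determined only there.
\<close>

lemma polynomial_pullback:
  assumes g: "g \<in> isometries Q V B" and P: "P \<in> polynomial_functions Q V"
  shows "\<exists>P'\<in>polynomial_functions Q V. \<forall>M\<in>arrow_maps. P' M = P (group_act Q V g M)"
  using P
proof induction
  case (const c)
  show ?case using polynomial_functions.const by (intro bexI[of _ "\<lambda>M. c"]) auto
next
  case (coeff \<alpha> v f)
  obtain u where u: "u \<in> carrier (V (tail Q \<alpha>))" "v = g (tail Q \<alpha>) u"
    using isometry_preimage[OF g _ coeff(2)] coeff(1) by auto
  let ?f = "\<lambda>x\<in>carrier (V (head Q \<alpha>)). f (g (head Q \<alpha>) x)"
  have "(\<lambda>x. f (g (head Q \<alpha>) x)) \<in> lhom (V (head Q \<alpha>)) scalar_space"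
    using g coeff lin_maps_imp_lhom[OF coeff(3)]
    by (intro functionalI)
      (simp_all add: isometries_iff endo_simps functional_add functional_smult)
  then have "?f \<in> lin_maps (V (head Q \<alpha>)) scalar_space"
    using coeff(1) by (intro restrict_in_lin_maps) (simp_all add: V_module)
  from polynomial_functions.coeff[OF coeff(1) u(1) this] show ?case
    by (rule bexI[rotated]) (use u coeff g in \<open>simp add: group_act_apply arrow_mapsD\<close>)
next
  case (add P1 P2)
  then obtain P1' P2' where "P1' \<in> polynomial_functions Q V" "P2' \<in> polynomial_functions Q V"
    "\<forall>M\<in>arrow_maps. P1' M = P1 (group_act Q V g M)" "\<forall>M\<in>arrow_maps. P2' M = P2 (group_act Q V g M)"
    by blast
  then show ?case
    by (intro bexI[of _ "\<lambda>M. P1' M + P2' M"]) (simp_all add: polynomial_functions.add)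
next
  case (mult P1 P2)
  then obtain P1' P2' where "P1' \<in> polynomial_functions Q V" "P2' \<in> polynomial_functions Q V"
    "\<forall>M\<in>arrow_maps. P1' M = P1 (group_act Q V g M)" "\<forall>M\<in>arrow_maps. P2' M = P2 (group_act Q V g M)"
    by blast
  then show ?case
    by (intro bexI[of _ "\<lambda>M. P1' M * P2' M"]) (simp_all add: polynomial_functions.mult)
qed

lemma group_act_compose:
  assumes g: "g \<in> isometries Q V B" and h: "h \<in> isometries Q V B" and M: "M \<in> arrow_maps"
  obtains k where "k \<in> isometries Q V B" "group_act Q V k M = group_act Q V g (group_act Q V h M)"
proof -
  define k where "k = restrict_endo (\<lambda>i v. g i (h i v))"
  have "graded_endo (\<lambda>i v. g i (h i v))"
    unfolding graded_endo_def
    by (intro ballI lhomI) (use g h in \<open>simp_all add: isometries_iff endo_simps\<close>)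
  moreover have "isometric (\<lambda>i v. g i (h i v))"
    using g h by (simp add: isometries_iff isometric_def endo_simps)
  ultimately have k: "k \<in> isometries Q V B" unfolding k_def by (rule restrict_endo_isometry)
  have "group_act Q V k M \<alpha> v = group_act Q V g (group_act Q V h M) \<alpha> v"
    if \<alpha>: "\<alpha> \<in> arcs Q" and v: "v \<in> carrier (V (tail Q \<alpha>))" for \<alpha> v
  proof -
    obtain w where w: "w \<in> carrier (V (tail Q \<alpha>))" "v = g (tail Q \<alpha>) w"
      using isometry_preimage[OF g _ v] \<alpha> by auto
    obtain u where u: "u \<in> carrier (V (tail Q \<alpha>))" "w = h (tail Q \<alpha>) u"
      using isometry_preimage[OF h _ w(1)] \<alpha> by auto
    have "v = k (tail Q \<alpha>) u" using \<alpha> u w by (simp add: k_def)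
    then have "group_act Q V k M \<alpha> v = k (head Q \<alpha>) (M \<alpha> u)"
      using group_act_apply[OF k \<alpha> u(1)] by simp
    also have "\<dots> = group_act Q V g (group_act Q V h M) \<alpha> v"
      using \<alpha> u w M by (simp add: k_def arrow_mapsD group_act_apply[OF g] group_act_apply[OF h])
    finally show ?thesis .
  qed
  then have "group_act Q V k M = group_act Q V g (group_act Q V h M)"
    by (auto simp: group_act_def fun_eq_iff restrict_def)
  with k show thesis by (rule that)
qed

text \<open>
  The polynomial functions vanishing on the orbit of \<open>M\<close> are stable under pulling back along the group,
  so they vanish on the whole orbit of \<open>N\<close>, not only at \<open>N\<close>.
\<close>

lemma orbit_specializes_trans:
  assumes "M \<in> arrow_maps" "N \<in> arrow_maps"
    and MN: "orbit_specializes M N" and NK: "orbit_specializes N K"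
  shows "orbit_specializes M K"
  unfolding orbit_specializes_def
proof (intro ballI impI)
  fix P assume P: "P \<in> polynomial_functions Q V"
    and vanish: "\<forall>g\<in>isometries Q V B. P (group_act Q V g M) = 0"
  have "P (group_act Q V g N) = 0" if g: "g \<in> isometries Q V B" for g
  proof -
    obtain P' where P': "P' \<in> polynomial_functions Q V"
      "\<And>M. M \<in> arrow_maps \<Longrightarrow> P' M = P (group_act Q V g M)"
      using polynomial_pullback[OF g P] by blast
    have "P' (group_act Q V h M) = 0" if h: "h \<in> isometries Q V B" for h
    proof -
      obtain k where "k \<in> isometries Q V B"
        "group_act Q V k M = group_act Q V g (group_act Q V h M)"
        using group_act_compose[OF g h assms(1)] .
      then show ?thesis using P'(2)[OF group_act_arrow_maps[OF h assms(1)]] vanish by metis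
    qed
    then have "P' N = 0" using MN P'(1) by (simp add: orbit_specializes_def)
    then show ?thesis using P'(2)[OF assms(2)] by simp
  qed
  then show "P K = 0" using NK P by (simp add: orbit_specializes_def)
qed

lemma orbit_specializes_refl:
  assumes M: "M \<in> eps_reps Q sv sa I V B"
  shows "orbit_specializes M M"
proof -
  have g: "restrict_endo (\<lambda>i v. v) \<in> isometries Q V B"
    by (rule restrict_endo_isometry) (auto simp: graded_endo_def isometric_def intro!: lhomI)
  have "group_act Q V (restrict_endo (\<lambda>i v. v)) M = M"
  proof (rule ext, rule ext)
    fix \<alpha> v
    have ext: "M \<in> extensional (arcs Q)" "\<alpha> \<in> arcs Q \<Longrightarrow> M \<alpha> \<in> extensional (carrier (V (tail Q \<alpha>)))"
      using M by (auto simp: eps_reps_def rep_variety_def PiE_def lin_maps_def)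
    show "group_act Q V (restrict_endo (\<lambda>i v. v)) M \<alpha> v = M \<alpha> v"
    proof (cases "\<alpha> \<in> arcs Q \<and> v \<in> carrier (V (tail Q \<alpha>))")
      case True
      then show ?thesis
        using group_act_apply[OF g, of \<alpha> v M] lhom_closed[OF eps_reps_lhom[OF M]] by simp
    next
      case False
      then show ?thesis using ext by (auto simp: group_act_def extensional_def)
    qed
  qed
  then show ?thesis using g unfolding orbit_specializes_def by metis
qed

lemma orbit_specializes_deg_le:
  assumes "orbit_specializes M N" "N \<in> rep_variety Q I V"
  shows "deg_le Q I V B M N"
  unfolding deg_le_def zariski_closure_def
proof (intro InterI)
  fix C assume C: "C \<in> {C. zariski_closed Q I V C \<and> {group_act Q V g M | g. g \<in> isometries Q V B} \<subseteq> C}"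
  then obtain F where F: "F \<subseteq> polynomial_functions Q V"
    "C = {M \<in> rep_variety Q I V. \<forall>P\<in>F. P M = 0}" unfolding zariski_closed_def by blast
  have "P N = 0" if "P \<in> F" for P
  proof -
    have "P (group_act Q V g M) = 0" if "g \<in> isometries Q V B" for g
    proof -
      have "group_act Q V g M \<in> C" using C that by auto
      then show ?thesis using F(2) \<open>P \<in> F\<close> by simp
    qed
    then show ?thesis using assms(1) F(1) that by (auto simp: orbit_specializes_def)
  qed
  then show "N \<in> C" using F(2) assms(2) by blast
qed

text \<open>
  An isomorphism \<open>\<phi>\<close> from \<open>N\<close> to \<open>X\<close> turns any isometric morphism \<open>\<psi>\<close> from \<open>K\<close> to \<open>X\<close> into
  \<open>\<phi>\<^sup>-\<^sup>1 \<psi>\<close>, an isometric endomorphism of \<open>V\<close> that intertwines \<open>K\<close> and \<open>N\<close>.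
\<close>

lemma form_rep_iso_factor:
  assumes iso: "form_rep_iso Q \<lparr>component = V, amap = N, form = B\<rparr> X"
    and N: "N \<in> arrow_maps"
    and \<psi>: "\<And>i. i \<in> verts Q \<Longrightarrow> \<psi> i \<in> lhom (V i) (component X i)"
    and \<psi>_form: "\<And>i j v w. \<lbrakk>i \<in> verts Q; j \<in> verts Q; v \<in> carrier (V i); w \<in> carrier (V j)\<rbrakk>
      \<Longrightarrow> form X i j (\<psi> i v) (\<psi> j w) = B i j v w"
    and \<psi>_amap: "\<And>\<alpha> v. \<lbrakk>\<alpha> \<in> arcs Q; v \<in> carrier (V (tail Q \<alpha>))\<rbrakk>
      \<Longrightarrow> amap X \<alpha> (\<psi> (tail Q \<alpha>) v) = \<psi> (head Q \<alpha>) (K \<alpha> v)"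
    and K: "K \<in> arrow_maps"
  obtains g where "graded_endo g" "isometric g"
    "\<forall>\<alpha>\<in>arcs Q. \<forall>v\<in>carrier (V (tail Q \<alpha>)). N \<alpha> (g (tail Q \<alpha>) v) = g (head Q \<alpha>) (K \<alpha> v)"
proof -
  obtain \<phi> where \<phi>_hom_bij: "\<forall>i\<in>verts Q. \<phi> i \<in> lhom (V i) (component X i) \<and>
        bij_betw (\<phi> i) (carrier (V i)) (carrier (component X i))"
    and \<phi>_amap: "\<forall>\<alpha>\<in>arcs Q. \<forall>v\<in>carrier (V (tail Q \<alpha>)).
        \<phi> (head Q \<alpha>) (N \<alpha> v) = amap X \<alpha> (\<phi> (tail Q \<alpha>) v)"
    and \<phi>_form: "\<forall>i\<in>verts Q. \<forall>j\<in>verts Q. \<forall>v\<in>carrier (V i). \<forall>w\<in>carrier (V j).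
        form X i j (\<phi> i v) (\<phi> j w) = B i j v w"
    using iso unfolding form_rep_iso_def by auto
  have \<phi>: "\<And>i. i \<in> verts Q \<Longrightarrow> \<phi> i \<in> lhom (V i) (component X i)"
    and bij: "\<And>i. i \<in> verts Q \<Longrightarrow> bij_betw (\<phi> i) (carrier (V i)) (carrier (component X i))"
    and amap: "\<And>\<alpha> v. \<alpha> \<in> arcs Q \<Longrightarrow> v \<in> carrier (V (tail Q \<alpha>)) \<Longrightarrow>
      \<phi> (head Q \<alpha>) (N \<alpha> v) = amap X \<alpha> (\<phi> (tail Q \<alpha>) v)"
    and form: "\<And>i j v w. \<lbrakk>i \<in> verts Q; j \<in> verts Q; v \<in> carrier (V i); w \<in> carrier (V j)\<rbrakk>
      \<Longrightarrow> form X i j (\<phi> i v) (\<phi> j w) = B i j v w"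
    using \<phi>_hom_bij \<phi>_amap \<phi>_form by simp_all
  define g where "g i v = inv_into (carrier (V i)) (\<phi> i) (\<psi> i v)" for i v
  have g: "g i v \<in> carrier (V i)" "\<phi> i (g i v) = \<psi> i v" if "i \<in> verts Q" "v \<in> carrier (V i)" for i v
  proof -
    have "\<psi> i v \<in> \<phi> i ` carrier (V i)"
      using lhom_closed[OF \<psi>[OF that(1)] that(2)] bij[OF that(1)] by (simp add: bij_betw_def)
    then show "g i v \<in> carrier (V i)" "\<phi> i (g i v) = \<psi> i v"
      unfolding g_def by (rule inv_into_into, rule f_inv_into_f)
  qed
  have eq: "x = y" if "i \<in> verts Q" "x \<in> carrier (V i)" "y \<in> carrier (V i)" "\<phi> i x = \<phi> i y" for i x y
    using bij[OF that(1)] that(2-) by (auto simp: bij_betw_def dest: inj_onD)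
  have "graded_endo g"
    unfolding graded_endo_def
  proof (intro ballI lhomI)
    fix i v c assume i: "i \<in> verts Q" and v: "v \<in> carrier (V i)"
    show "g i v \<in> carrier (V i)" by (rule g(1)[OF i v])
    show "g i (c \<odot>\<^bsub>V i\<^esub> v) = c \<odot>\<^bsub>V i\<^esub> g i v"
      by (rule eq[OF i]) (use i v g in \<open>simp_all add: lhom_smult[OF \<phi>] lhom_smult[OF \<psi>]\<close>)
    fix w assume w: "w \<in> carrier (V i)"
    show "g i (v \<oplus>\<^bsub>V i\<^esub> w) = g i v \<oplus>\<^bsub>V i\<^esub> g i w"
      by (rule eq[OF i]) (use i v w g in \<open>simp_all add: lhom_add[OF \<phi>] lhom_add[OF \<psi>]\<close>)
  qed
  moreover have "isometric g"
    unfolding isometric_def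
  proof (intro ballI)
    fix i j v w assume *: "i \<in> verts Q" "j \<in> verts Q" "v \<in> carrier (V i)" "w \<in> carrier (V j)"
    then have "B i j (g i v) (g j w) = form X i j (\<phi> i (g i v)) (\<phi> j (g j w))"
      using form[of i j "g i v" "g j w"] g(1) by simp
    then show "B i j (g i v) (g j w) = B i j v w" using * g(2) \<psi>_form by simp
  qed
  moreover have "N \<alpha> (g (tail Q \<alpha>) v) = g (head Q \<alpha>) (K \<alpha> v)"
    if "\<alpha> \<in> arcs Q" "v \<in> carrier (V (tail Q \<alpha>))" for \<alpha> v
    by (rule eq[of "head Q \<alpha>"]) (use that g \<psi>_amap amap N K in \<open>simp_all add: arrow_mapsD\<close>)
  ultimately show thesis using that by simp
qed

text \<open>
  The curve is \<open>t \<mapsto> (g \<lambda>(t)) \<cdot> M\<close>, where the isometry \<open>g\<close> carries \<open>gr M\<close> to \<open>N\<close>.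
\<close>

lemma extension_specializes:
  assumes M: "M \<in> eps_reps Q sv sa I V B" and N: "N \<in> eps_reps Q sv sa I V B"
    and L: "isotropic_subrep Q V B M L"
    and iso: "form_rep_iso Q \<lparr>component = V, amap = N, form = B\<rparr>
      (form_rep_sum (hyperbolic_rep Q sv sa \<epsilon> (\<lambda>j. V j\<lparr>carrier := L j\<rparr>) M)
         (perp_quotient_rep Q V B M L))"
  shows "orbit_specializes M N"
proof -
  have L_subspace: "VectorSpace.subspace class_ring (L i) (V i)" if "i \<in> verts Q" for i
    using L that by (simp add: isotropic_subrep_def subrep_def)
  have L_iso: "B i j l m = 0" if "i \<in> verts Q" "j \<in> verts Q" "l \<in> L i" "m \<in> L j" for i j l m
    using L that by (auto simp: isotropic_subrep_def perp_def subset_iff)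
  obtain e e' where e: "graded_endo e" "graded_endo e'" "adjoint e e'"
    "\<forall>i\<in>verts Q. \<forall>v\<in>carrier (V i). e i v \<in> L i"
    "\<forall>i\<in>verts Q. \<forall>l\<in>L i. e i l = l"
    "\<forall>i\<in>verts Q. \<forall>v\<in>carrier (V i). e i (e' i v) = \<zero>\<^bsub>V i\<^esub>"
    using isotropic_projection[of L, OF L_subspace L_iso] .
  interpret isotropic_splitting Q sv sa \<epsilon> V B M L e e'
  proof (intro isotropic_splitting.intro isotropic_splitting_axioms.intro symmetric_quadratic_space_axioms)
    show "M \<alpha> \<in> lhom (V (tail Q \<alpha>)) (V (head Q \<alpha>))" if "\<alpha> \<in> arcs Q" for \<alpha>
      using eps_reps_lhom[OF M that] .
    show "M \<alpha> l \<in> L (head Q \<alpha>)" if "\<alpha> \<in> arcs Q" "l \<in> L (tail Q \<alpha>)" for \<alpha> l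
      using L that by (auto simp: isotropic_subrep_def subrep_def)
    show "submodule class_ring (L i) (V i)" if "i \<in> verts Q" for i
      using L_subspace[OF that] by (simp add: VectorSpace.subspace_def)
  qed (use M e L_iso in \<open>auto simp: eps_reps_def\<close>)
  have gr_maps: "gr \<in> arrow_maps" by (simp add: arrow_maps_def gr_closed)
  obtain g where g: "graded_endo g" "isometric g"
    and N_g: "\<forall>\<alpha>\<in>arcs Q. \<forall>v\<in>carrier (V (tail Q \<alpha>)). N \<alpha> (g (tail Q \<alpha>) v) = g (head Q \<alpha>) (gr \<alpha> v)"
    using form_rep_iso_factor[OF iso eps_reps_arrow_maps[OF N] to_degeneration_hom
        to_degeneration_form to_degeneration_gr gr_maps] .
  define G where "G t = restrict_endo (\<lambda>i v. g i (torus t i v))" for t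
  have G: "G t \<in> isometries Q V B" if t: "t \<noteq> 0" for t
  proof -
    have "graded_endo (\<lambda>i v. g i (torus t i v))"
      unfolding graded_endo_def
      by (intro ballI lhomI) (simp_all add: endo_simps[OF g(1)] endo_simps[OF torus_endo])
    moreover have "isometric (\<lambda>i v. g i (torus t i v))"
      using g(2) torus_isometric[OF t] endo_simps[OF torus_endo] unfolding isometric_def by simp
    ultimately show ?thesis unfolding G_def by (rule restrict_endo_isometry)
  qed
  show ?thesis
    unfolding orbit_specializes_def
  proof (intro ballI impI)
    fix P assume P: "P \<in> polynomial_functions Q V"
      and vanish: "\<forall>g\<in>isometries Q V B. P (group_act Q V g M) = 0"
    have "\<exists>q. poly q 0 = f (N \<alpha> v) \<and> (\<forall>t. t \<noteq> 0 \<longrightarrow> poly q t = f (group_act Q V (G t) M \<alpha> v))"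
      if \<alpha>: "\<alpha> \<in> arcs Q" and v: "v \<in> carrier (V (tail Q \<alpha>))"
        and f: "f \<in> lin_maps (V (head Q \<alpha>)) scalar_space" for \<alpha> v f
    proof -
      obtain u where u: "u \<in> carrier (V (tail Q \<alpha>))" "v = g (tail Q \<alpha>) u"
        using isometry_preimage[OF restrict_endo_isometry[OF g] _ v] \<alpha> by auto
      have "(\<lambda>x. f (g (head Q \<alpha>) x)) \<in> lhom (V (head Q \<alpha>)) scalar_space"
        using \<alpha> lin_maps_imp_lhom[OF f]
        by (intro functionalI) (simp_all add: endo_simps[OF g(1)] functional_add functional_smult)
      from torus_conjugate_polynomial[OF \<alpha> u(1) this]
      obtain q where q: "poly q 0 = f (g (head Q \<alpha>) (gr \<alpha> u))"
        "\<forall>t. t \<noteq> 0 \<longrightarrow> poly q t =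
          f (g (head Q \<alpha>) (torus t (head Q \<alpha>) (M \<alpha> (torus (1/t) (tail Q \<alpha>) u))))" by blast
      have "poly q t = f (group_act Q V (G t) M \<alpha> v)" if t: "t \<noteq> 0" for t
      proof -
        have u': "torus (1/t) (tail Q \<alpha>) u \<in> carrier (V (tail Q \<alpha>))"
          using \<alpha> u by (simp add: endo_simps[OF torus_endo])
        \<comment> \<open>\<open>\<lambda>(1/t)\<close> inverts \<open>\<lambda>(t)\<close>, so this names the preimage of \<open>v\<close> under \<open>G t\<close>\<close>
        then have "v = G t (tail Q \<alpha>) (torus (1/t) (tail Q \<alpha>) u)"
          using \<alpha> u torus_inverse[OF t] by (simp add: G_def)
        then show ?thesis
          using group_act_apply[OF G[OF t] \<alpha> u', of M] q(2)[rule_format, OF t] \<alpha> u' by (simp add: G_def M_closed)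
      qed
      then show ?thesis using q(1) N_g[rule_format, OF \<alpha> u(1)] u(2) by auto
    qed
    then obtain q where q: "poly q 0 = P N" "\<forall>t. t \<noteq> 0 \<longrightarrow> poly q t = P (group_act Q V (G t) M)"
      using polynomial_along_curve[OF P, of N "\<lambda>t. group_act Q V (G t) M"] by blast
    then have "q = 0" using vanish G by (intro complex_poly_eq_0_if_vanishing_off_0) simp
    then show "P N = 0" using q(1) by simp
  qed
qed

end

theorem corollary3p3:
  fixes Q :: "('v, 'e) pre_digraph" and sv :: "'v \<Rightarrow> 'v" and sa :: "'e \<Rightarrow> 'e"
    and I :: "('v \<times> 'e list \<Rightarrow> complex) set" and \<epsilon> :: complex
    and V :: "'v \<Rightarrow> (complex, 'a) module" and B :: "'v \<Rightarrow> 'v \<Rightarrow> 'a \<Rightarrow> 'a \<Rightarrow> complex"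
    and M N :: "'e \<Rightarrow> 'a \<Rightarrow> 'a"
  assumes "symmetric_quiver_algebra Q sv sa I"
    and "\<epsilon> \<in> {1, -1}"
    and "quadratic_space Q sv \<epsilon> V B"
    and "M \<in> eps_reps Q sv sa I V B" and "N \<in> eps_reps Q sv sa I V B"
    and "ext_le Q sv sa I \<epsilon> V B M N"
  shows "deg_le Q I V B M N"
proof -
  interpret symmetric_quadratic_space Q sv sa \<epsilon> V B
    using assms(1-3)
    by (intro symmetric_quadratic_space.intro symmetric_quadratic_space_axioms.intro)
      (simp_all add: symmetric_quiver_algebra_def)
  obtain k :: nat and Ms where Ms: "1 \<le> k" "Ms 1 = M" "Ms k = N"
    "\<And>i. i \<in> {1..k} \<Longrightarrow> Ms i \<in> eps_reps Q sv sa I V B"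
    and step: "\<And>i. i \<in> {2..k} \<Longrightarrow> \<exists>L. isotropic_subrep Q V B (Ms (i - 1)) L \<and>
           form_rep_iso Q
             \<lparr> component = V, amap = Ms i, form = B \<rparr>
             (form_rep_sum
                (hyperbolic_rep Q sv sa \<epsilon> (\<lambda>j. V j\<lparr>carrier := L j\<rparr>) (Ms (i - 1)))
                (perp_quotient_rep Q V B (Ms (i - 1)) L))"
    using assms(6) unfolding ext_le_def by blast
  have "orbit_specializes M (Ms i)" if "1 \<le> i" "i \<le> k" for i
    using that
  proof (induction i rule: nat_induct_at_least)
    case base
    then show ?case using orbit_specializes_refl assms(4) Ms(2) by simp
  next
    case (Suc i)
    then have reps: "Ms i \<in> eps_reps Q sv sa I V B" "Ms (Suc i) \<in> eps_reps Q sv sa I V B"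
      using Ms(4) by auto
    have "orbit_specializes (Ms i) (Ms (Suc i))"
      using step[of "Suc i"] Suc extension_specializes[OF reps] by auto
    then show ?case
      using Suc orbit_specializes_trans[OF eps_reps_arrow_maps[OF assms(4)] eps_reps_arrow_maps[OF reps(1)]]
      by simp
  qed
  then have "orbit_specializes M N" using Ms(1,3) by blast
  then show ?thesis using orbit_specializes_deg_le assms(5) by (simp add: eps_reps_def)
qed

end
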